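(* Let $\mathcal{B} \subset \mathcal{A}$ be a regular inclusion of simple unital $C^*$-algebras such that there exists a finite-index conditional expectation from $\mathcal{A}$ onto $\mathcal{B}$. Then the inclusion $\mathcal{B} \subset \mathcal{A}$ has finite depth and the depth is at most $2$.
   Context: Inclusions of unital $C^*$-algebras have a common unit. The inclusion $\mathcal{B} \subset \mathcal{A}$ is regular if $\mathcal{N}_{\mathcal{A}}(\mathcal{B}) = \{u \in \mathcal{U}(\mathcal{A}) : u\mathcal{B}u^* = \mathcal{B}\}$ generates $\mathcal{A}$ as a $C^*$-algebra. A conditional expectation $E: \mathcal{A} \to \mathcal{B}$ has finite index if there is a finite set $\{\lambda_i\} \subset \mathcal{A}$ (a quasi-basis) with $x = \sum_i E(x\lambda_i)\lambda_i^*$ for all $x \in \mathcal{A}$; then $\mathrm{Ind}_W(E) = \sum_i \lambda_i\lambda_i^*$ is its Watatani index (independent of the quasi-basis; a scalar if $\mathcal{A}$ is simple). For an inclusion of simple unital $C^*$-algebras admitting a finite-index conditional expectation, there is a unique conditional expectation $E_0: \mathcal{A} \to \mathcal{B}$ with smallest Watatani index, called the minimal conditional expectation. Watatani's $C^*$-basic construction: for a finite-index conditional expectation $E: \mathcal{A} \to \mathcal{B}$, $\mathcal{A}$ is a Hilbert $\mathcal{B}$-module with inner product $\langle x,y\rangle_{\mathcal{B}} = E(x^*y)$. View $\mathcal{A}$ inside the adjointable operators $\mathcal{L}_{\mathcal{B}}(\mathcal{A})$ by left multiplication and let $e_1 \in \mathcal{L}_{\mathcal{B}}(\mathcal{A})$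 be the (Jones) projection $x \mapsto E(x)$. Then $\mathcal{A}_1 := \mathrm{span}\{x e_1 y : x,y \in \mathcal{A}\} = C^*(\mathcal{A} \cup \{e_1\})$. There is a unique finite-index conditional expectation (the dual of $E$) $E_1: \mathcal{A}_1 \to \mathcal{A}$ with $E_1(x e_1 y) = \mathrm{Ind}_W(E)^{-1} xy$ for all $x, y \in \mathcal{A}$. Iterating, one gets a tower $\mathcal{A}_{-1} := \mathcal{B} \subset \mathcal{A}_0 := \mathcal{A} \subset \mathcal{A}_1 \subset \mathcal{A}_2 \subset \cdots$, where $\mathcal{A}_{k+1} = C^*(\mathcal{A}_k \cup \{e_{k+1}\})$ is the $C^*$-basic construction of $\mathcal{A}_{k-1} \subset \mathcal{A}_k$ with respect to $E_k : \mathcal{A}_k \to \mathcal{A}_{k-1}$, with Jones projection $e_{k+1}$. In this statement the tower is formed starting from the minimal conditional expectation, i.e. with $E$ equal to $E_0$. The inclusion $\mathcal{B} \subset \mathcal{A}$ has finite depth if $\mathcal{B}' \cap \mathcal{A}_k = (\mathcal{B}' \cap \mathcal{A}_{k-1})\, e_k\, (\mathcal{B}' \cap \mathcal{A}_{k-1})$ for some $k \geq 1$, where the right-hand side denotes the linear span of the products $x e_k y$ and $\mathcal{B}' \cap \mathcal{A}_k$ is the set of elements of $\mathcal{A}_k$ commuting with $\mathcal{B}$. The least such $k$ is the depth. *)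

theory Defs
  imports "HOL-Analysis.Analysis"
begin

section \<open>Unital C*-algebras\<close>

text \<open>
  A type of this class is a nonzero unital complex C*-algebra. All algebras of an inclusion, and of
  the tower built on it, are realised as C*-subalgebras (with the same unit) of one such type.
\<close>

class unital_cstar_algebra = real_normed_algebra_1 + banach +
  fixes scaleC :: "complex \<Rightarrow> 'a \<Rightarrow> 'a"
    and star :: "'a \<Rightarrow> 'a"
  assumes scaleC_add_right: "scaleC c (x + y) = scaleC c x + scaleC c y"
    and scaleC_add_left: "scaleC (c + d) x = scaleC c x + scaleC d x"
    and scaleC_scaleC: "scaleC c (scaleC d x) = scaleC (c * d) x"
    and scaleR_scaleC: "scaleR r x = scaleC (complex_of_real r) x"
    and mult_scaleC_left: "scaleC c x * y = scaleC c (x * y)"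
    and mult_scaleC_right: "x * scaleC c y = scaleC c (x * y)"
    and norm_scaleC: "norm (scaleC c x) = cmod c * norm x"
    and star_star: "star (star x) = x"
    and star_add: "star (x + y) = star x + star y"
    and star_mult: "star (x * y) = star y * star x"
    and star_scaleC: "star (scaleC c x) = scaleC (cnj c) (star x)"
    and cstar_identity: "norm (star x * x) = (norm x)\<^sup>2"

instantiation complex :: unital_cstar_algebra
begin
definition scaleC_complex :: "complex \<Rightarrow> complex \<Rightarrow> complex" where "scaleC_complex = (*)"
definition star_complex :: "complex \<Rightarrow> complex" where "star_complex = cnj"
instance
  by standard (simp_all add: scaleC_complex_def star_complex_def algebra_simps scaleR_conv_of_real
      norm_mult power2_eq_square)
end

global_interpretation cstar: vector_space "scaleC :: complex \<Rightarrow> 'a \<Rightarrow> 'a::unital_cstar_algebra"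
  defines cspan = "cstar.span"
proof unfold_locales
  show "scaleC 1 x = x" for x :: 'a
    using scaleR_scaleC[of 1 x] by simp
qed (simp_all add: scaleC_add_right scaleC_add_left scaleC_scaleC)

definition unital_cstar_subalgebra :: "'a::unital_cstar_algebra set \<Rightarrow> bool" where
  "unital_cstar_subalgebra A \<longleftrightarrow>
     1 \<in> A \<and> closed A \<and>
     (\<forall>x\<in>A. \<forall>y\<in>A. x + y \<in> A) \<and> (\<forall>x\<in>A. \<forall>y\<in>A. x * y \<in> A) \<and>
     (\<forall>c. \<forall>x\<in>A. scaleC c x \<in> A) \<and> (\<forall>x\<in>A. star x \<in> A)"

text \<open>The order of the C*-algebra \<open>A\<close>: positive elements are those of the form \<open>b* b\<close>.\<close>

definition cstar_le :: "'a::unital_cstar_algebra set \<Rightarrow> 'a \<Rightarrow> 'a \<Rightarrow> bool" where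
  "cstar_le A x y \<longleftrightarrow> (\<exists>b\<in>A. y - x = star b * b)"

text \<open>As \<open>1 \<in> A\<close>, closure of \<open>I\<close> under scalars is contained in its closure under products with \<open>A\<close>.\<close>

definition closed_two_sided_ideal ::
    "'a::unital_cstar_algebra set \<Rightarrow> 'a set \<Rightarrow> bool" where
  "closed_two_sided_ideal A I \<longleftrightarrow>
     I \<subseteq> A \<and> closed I \<and> 0 \<in> I \<and> (\<forall>x\<in>I. \<forall>y\<in>I. x + y \<in> I) \<and>
     (\<forall>a\<in>A. \<forall>x\<in>I. a * x \<in> I \<and> x * a \<in> I)"

definition simple_cstar :: "'a::unital_cstar_algebra set \<Rightarrow> bool" where
  "simple_cstar A \<longleftrightarrow> (\<forall>I. closed_two_sided_ideal A I \<longrightarrow> I = {0} \<or> I = A)"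

definition normalizer :: "'a::unital_cstar_algebra set \<Rightarrow> 'a set \<Rightarrow> 'a set" where
  "normalizer A B =
     {u \<in> A. star u * u = 1 \<and> u * star u = 1 \<and> (\<lambda>b. u * b * star u) ` B = B}"

text \<open>The normalizer contains \<open>1\<close>, so the C*-algebra it generates is the unital one.\<close>

definition regular_inclusion :: "'a::unital_cstar_algebra set \<Rightarrow> 'a set \<Rightarrow> bool" where
  "regular_inclusion A B \<longleftrightarrow> unital_cstar_subalgebra hull (normalizer A B) = A"

definition rel_commutant :: "'a::unital_cstar_algebra set \<Rightarrow> 'a set \<Rightarrow> 'a set" where
  "rel_commutant B A = {x \<in> A. \<forall>b\<in>B. b * x = x * b}"


section \<open>Conditional expectations of finite index\<close>

text \<open>
  Maps out of an algebra \<open>A\<close> are total functions on the ambient type, of which only the values on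
  \<open>A\<close> matter.
\<close>

definition conditional_expectation ::
    "'a::unital_cstar_algebra set \<Rightarrow> 'a set \<Rightarrow> ('a \<Rightarrow> 'a) \<Rightarrow> bool" where
  "conditional_expectation A B E \<longleftrightarrow>
     (\<forall>x\<in>A. E x \<in> B) \<and> (\<forall>b\<in>B. E b = b) \<and>
     (\<forall>x\<in>A. \<forall>y\<in>A. E (x + y) = E x + E y) \<and> (\<forall>c. \<forall>x\<in>A. E (scaleC c x) = scaleC c (E x)) \<and>
     (\<forall>b\<in>B. \<forall>x\<in>A. E (b * x) = b * E x \<and> E (x * b) = E x * b) \<and>
     (\<forall>x\<in>A. cstar_le B 0 (E (star x * x)))"

definition quasi_basis :: "'a::unital_cstar_algebra set \<Rightarrow> ('a \<Rightarrow> 'a) \<Rightarrow> 'a set \<Rightarrow> bool" where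
  "quasi_basis A E \<Lambda> \<longleftrightarrow>
     finite \<Lambda> \<and> \<Lambda> \<subseteq> A \<and> (\<forall>x\<in>A. x = (\<Sum>l\<in>\<Lambda>. E (x * l) * star l))"

definition finite_index_expectation ::
    "'a::unital_cstar_algebra set \<Rightarrow> 'a set \<Rightarrow> ('a \<Rightarrow> 'a) \<Rightarrow> bool" where
  "finite_index_expectation A B E \<longleftrightarrow>
     conditional_expectation A B E \<and> (\<exists>\<Lambda>. quasi_basis A E \<Lambda>)"

text \<open>Independence of the quasi-basis is the lemma \<open>watatani_index_eq\<close> below.\<close>

definition watatani_index :: "'a::unital_cstar_algebra set \<Rightarrow> ('a \<Rightarrow> 'a) \<Rightarrow> 'a" where
  "watatani_index A E = (THE w. \<exists>\<Lambda>. quasi_basis A E \<Lambda> \<and> w = (\<Sum>l\<in>\<Lambda>. l * star l))"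

definition minimal_expectation ::
    "'a::unital_cstar_algebra set \<Rightarrow> 'a set \<Rightarrow> ('a \<Rightarrow> 'a) \<Rightarrow> bool" where
  "minimal_expectation A B E \<longleftrightarrow>
     finite_index_expectation A B E \<and>
     (\<forall>F. finite_index_expectation A B F \<longrightarrow>
        cstar_le A (watatani_index A E) (watatani_index A F))"

lemma star_zero: "star (0 :: 'a::unital_cstar_algebra) = 0"
  using star_add[of "0 :: 'a" 0] by simp

lemma star_one: "star (1 :: 'a::unital_cstar_algebra) = 1"
  by (metis mult_1 mult_1_right star_mult star_star)

lemma star_uminus: "star (- x) = - star (x :: 'a::unital_cstar_algebra)"
  using star_scaleC[of "-1" x] by simp

lemma star_diff: "star (x - y) = star x - star (y :: 'a::unital_cstar_algebra)"
  using star_add[of x "- y"] by (simp add: star_uminus)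

lemma star_sum:
  "star (\<Sum>i\<in>I. f i) = (\<Sum>i\<in>I. star (f i) :: 'a::unital_cstar_algebra)"
  by (induction I rule: infinite_finite_induct) (auto simp: star_zero star_add)

lemma conditional_expectation_star:
  assumes A: "unital_cstar_subalgebra A" and E: "conditional_expectation A B E" and x: "x \<in> A"
  shows "E (star x) = star (E x)"
proof -
  note Ad = A[unfolded unital_cstar_subalgebra_def]
  note Ed = E[unfolded conditional_expectation_def]
  have selfadj: "star (E h) = E h" if h: "h \<in> A" "star h = h" for h
  proof -
    have sq: "star (E (k * k)) = E (k * k)" if k: "k \<in> A" "star k = k" for k
    proof -
      have "cstar_le B 0 (E (star k * k))" using Ed k(1) by blast
      then obtain b where "E (k * k) = star b * b"
        unfolding cstar_le_def k(2) by auto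
      then show ?thesis by (simp add: star_mult star_star)
    qed
    have mem: "h * h \<in> A" "h + h \<in> A" "h * h + (h + h) \<in> A" "h + 1 \<in> A" "1 \<in> A" "1 * 1 \<in> A"
      using Ad h by auto
    have "(h + 1) * (h + 1) = (h * h + (h + h)) + 1 * 1" by (simp add: algebra_simps)
    then have eq: "E ((h + 1) * (h + 1)) = E (h * h) + (E h + E h) + E (1 * 1)"
      using Ed mem h(1) by metis
    have "star (E ((h + 1) * (h + 1))) = E ((h + 1) * (h + 1))"
      by (rule sq) (use mem h(2) in \<open>auto simp: star_add star_one\<close>)
    then have "star (E h) + star (E h) = E h + E h"
      unfolding eq using sq[OF h] sq[of 1] mem by (simp add: star_add star_one)
    then have "2 *\<^sub>R star (E h) = 2 *\<^sub>R E h" by (simp only: scaleR_2)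
    then show ?thesis by simp
  qed
  define h where "h = x + star x"
  define k where "k = scaleC \<i> x + scaleC (- \<i>) (star x)"
  have mem: "star x \<in> A" "h \<in> A" "k \<in> A" "scaleC \<i> x \<in> A" "scaleC (- \<i>) (star x) \<in> A"
    unfolding h_def k_def using Ad x by blast+
  have sh: "star (E h) = E h"
    by (rule selfadj) (use mem in \<open>auto simp: h_def star_add star_star add.commute\<close>)
  have sk: "star (E k) = E k"
    by (rule selfadj)
      (use mem in \<open>auto simp: k_def star_add star_diff star_uminus star_star star_scaleC add.commute\<close>)
  have Eh: "E h = E x + E (star x)" using Ed x mem unfolding h_def by metis
  have "E k = E (scaleC \<i> x) + E (scaleC (- \<i>) (star x))"
    using Ed mem(4,5) unfolding k_def by blast
  moreover have "E (scaleC c y) = scaleC c (E y)" if "y \<in> A" for c y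
    using Ed that by blast
  ultimately have Ek: "E k = scaleC \<i> (E x) + scaleC (- \<i>) (E (star x))"
    by (simp only: x mem(1))
  have 1: "star (E x) + star (E (star x)) = E x + E (star x)"
    using sh unfolding Eh by (simp add: star_add)
  have "scaleC (- \<i>) (star (E x)) + scaleC \<i> (star (E (star x)))
      = scaleC \<i> (E x) + scaleC (- \<i>) (E (star x))"
    using sk unfolding Ek by (simp add: star_add star_diff star_scaleC)
  then have "scaleC \<i> (scaleC (- \<i>) (star (E x)) + scaleC \<i> (star (E (star x))))
      = scaleC \<i> (scaleC \<i> (E x) + scaleC (- \<i>) (E (star x)))" by simp
  then have "star (E x) - star (E (star x)) = - E x + E (star x)"
    by (simp add: scaleC_add_right scaleC_scaleC cstar.scale_right_diff_distrib)
  with 1 have "(star (E x) + star (E (star x))) + (star (E x) - star (E (star x)))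
      = (E x + E (star x)) + (- E x + E (star x))" by simp
  then have "star (E x) + star (E x) = E (star x) + E (star x)" by simp
  then have "2 *\<^sub>R star (E x) = 2 *\<^sub>R E (star x)" by (simp only: scaleR_2)
  then show ?thesis by simp
qed

lemma watatani_index_eq:
  assumes A: "unital_cstar_subalgebra A" and E: "conditional_expectation A B E"
    and L: "quasi_basis A E \<Lambda>"
  shows "watatani_index A E = (\<Sum>l\<in>\<Lambda>. l * star l)"
  unfolding watatani_index_def
proof (rule the_equality)
  fix w
  assume "\<exists>M. quasi_basis A E M \<and> w = (\<Sum>m\<in>M. m * star m)"
  then obtain M where M: "quasi_basis A E M" and w: "w = (\<Sum>m\<in>M. m * star m)" by blast
  have mult: "x * y \<in> A" "star x \<in> A" if "x \<in> A" "y \<in> A" for x y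
    using A that unfolding unital_cstar_subalgebra_def by auto
  have inA: "l \<in> A" if "l \<in> \<Lambda>" for l using L that unfolding quasi_basis_def by auto
  have inA': "m \<in> A" if "m \<in> M" for m using M that unfolding quasi_basis_def by auto
  have expand: "m = (\<Sum>l\<in>\<Lambda>. l * E (star l * m))" if "m \<in> M" for m
  proof -
    have m: "m \<in> A" by (rule inA'[OF that])
    have "star m = (\<Sum>l\<in>\<Lambda>. E (star m * l) * star l)"
      using L mult[OF m m] unfolding quasi_basis_def by blast
    then have "star (star m) = star (\<Sum>l\<in>\<Lambda>. E (star m * l) * star l)" by simp
    also have "\<dots> = (\<Sum>l\<in>\<Lambda>. l * E (star l * m))"
      unfolding star_sum
    proof (rule sum.cong[OF refl])
      fix l assume l: "l \<in> \<Lambda>"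
      have "star (E (star m * l)) = E (star (star m * l))"
        using conditional_expectation_star[OF A E] mult inA[OF l] m by metis
      then show "star (E (star m * l) * star l) = l * E (star l * m)"
        by (simp add: star_mult star_star)
    qed
    finally show ?thesis by (simp add: star_star)
  qed
  have "w = (\<Sum>m\<in>M. \<Sum>l\<in>\<Lambda>. l * E (star l * m) * star m)"
    unfolding w
  proof (rule sum.cong[OF refl])
    fix m assume "m \<in> M"
    from expand[OF this] show "m * star m = (\<Sum>l\<in>\<Lambda>. l * E (star l * m) * star m)"
      by (metis sum_distrib_right)
  qed
  also have "\<dots> = (\<Sum>l\<in>\<Lambda>. l * (\<Sum>m\<in>M. E (star l * m) * star m))"
    by (subst sum.swap) (simp add: sum_distrib_left mult.assoc)
  also have "\<dots> = (\<Sum>l\<in>\<Lambda>. l * star l)"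
  proof (rule sum.cong[OF refl])
    fix l assume "l \<in> \<Lambda>"
    then have "star l \<in> A" using inA mult by blast
    then have "star l = (\<Sum>m\<in>M. E (star l * m) * star m)"
      using M unfolding quasi_basis_def by blast
    then show "l * (\<Sum>m\<in>M. E (star l * m) * star m) = l * star l" by simp
  qed
  finally show "w = (\<Sum>l\<in>\<Lambda>. l * star l)" .
qed (use L in blast)


section \<open>The C*-basic construction\<close>

text \<open>
  For \<open>E\<close> from \<open>A\<close> to \<open>B\<close>, operators on the Hilbert \<open>B\<close>-module \<open>A\<close> are functions extensional on
  \<open>A\<close>; composition of operators is \<^const>\<open>compose\<close>.
\<close>

definition module_inner :: "('a \<Rightarrow> 'a) \<Rightarrow> 'a::unital_cstar_algebra \<Rightarrow> 'a \<Rightarrow> 'a" where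
  "module_inner E x y = E (star x * y)"

definition is_module_adjoint ::
    "'a::unital_cstar_algebra set \<Rightarrow> ('a \<Rightarrow> 'a) \<Rightarrow> ('a \<Rightarrow> 'a) \<Rightarrow> ('a \<Rightarrow> 'a) \<Rightarrow> bool" where
  "is_module_adjoint A E T S \<longleftrightarrow>
     (\<forall>x\<in>A. \<forall>y\<in>A. module_inner E (T x) y = module_inner E x (S y))"

definition adjointable_operators ::
    "'a::unital_cstar_algebra set \<Rightarrow> ('a \<Rightarrow> 'a) \<Rightarrow> ('a \<Rightarrow> 'a) set" where
  "adjointable_operators A E = {T \<in> A \<rightarrow>\<^sub>E A. \<exists>S \<in> A \<rightarrow>\<^sub>E A. is_module_adjoint A E T S}"

definition left_mult_operator :: "'a::unital_cstar_algebra set \<Rightarrow> 'a \<Rightarrow> 'a \<Rightarrow> 'a" where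
  "left_mult_operator A a = (\<lambda>x\<in>A. a * x)"

definition jones_operator :: "'a set \<Rightarrow> ('a \<Rightarrow> 'a) \<Rightarrow> 'a \<Rightarrow> 'a" where
  "jones_operator A E = (\<lambda>x\<in>A. E x)"

text \<open>
  The linear span of the operators \<open>x e\<^sub>1 y\<close> with \<open>x, y \<in> A\<close>; coefficients are absorbed into \<open>x\<close>.
\<close>

definition basic_construction_operators ::
    "'a::unital_cstar_algebra set \<Rightarrow> ('a \<Rightarrow> 'a) \<Rightarrow> ('a \<Rightarrow> 'a) set" where
  "basic_construction_operators A E =
     {T \<in> adjointable_operators A E. \<exists>(n::nat) x y.
        (\<forall>i<n. x i \<in> A \<and> y i \<in> A) \<and>
        T = (\<lambda>\<xi>\<in>A. \<Sum>i<n. compose A (left_mult_operator A (x i))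
                (compose A (jones_operator A E) (left_mult_operator A (y i))) \<xi>)}"

text \<open>
  \<open>A1 \<supseteq> A\<close> together with \<open>e \<in> A1\<close> is the basic construction if it is identified with the concrete
  algebra of operators by a *-isomorphism that turns \<open>A\<close> into left multiplications and \<open>e\<close> into the
  Jones projection. Such an isomorphism is automatically isometric, and determined by these data.
\<close>

definition basic_construction ::
    "'a::unital_cstar_algebra set \<Rightarrow> ('a \<Rightarrow> 'a) \<Rightarrow> 'a set \<Rightarrow> 'a \<Rightarrow> bool" where
  "basic_construction A E A1 e \<longleftrightarrow>
     unital_cstar_subalgebra A1 \<and> A \<subseteq> A1 \<and> e \<in> A1 \<and>
     (\<exists>\<pi>. bij_betw \<pi> A1 (basic_construction_operators A E) \<and>
        (\<forall>x\<in>A1. \<forall>y\<in>A1. \<pi> (x + y) = (\<lambda>\<xi>\<in>A. \<pi> x \<xi> + \<pi> y \<xi>)) \<and>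
        (\<forall>c. \<forall>x\<in>A1. \<pi> (scaleC c x) = (\<lambda>\<xi>\<in>A. scaleC c (\<pi> x \<xi>))) \<and>
        (\<forall>x\<in>A1. \<forall>y\<in>A1. \<pi> (x * y) = compose A (\<pi> x) (\<pi> y)) \<and>
        (\<forall>x\<in>A1. is_module_adjoint A E (\<pi> x) (\<pi> (star x))) \<and>
        (\<forall>a\<in>A. \<pi> a = left_mult_operator A a) \<and>
        \<pi> e = jones_operator A E)"

definition cstar_inverse :: "'a::unital_cstar_algebra \<Rightarrow> 'a" where
  "cstar_inverse a = (THE b. a * b = 1 \<and> b * a = 1)"

definition dual_expectation ::
    "'a::unital_cstar_algebra set \<Rightarrow> ('a \<Rightarrow> 'a) \<Rightarrow> 'a set \<Rightarrow> 'a \<Rightarrow> ('a \<Rightarrow> 'a) \<Rightarrow> bool" where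
  "dual_expectation A E A1 e E1 \<longleftrightarrow>
     finite_index_expectation A1 A E1 \<and>
     (\<forall>x\<in>A. \<forall>y\<in>A. E1 (x * e * y) = cstar_inverse (watatani_index A E) * (x * y))"


section \<open>The tower and the depth\<close>

text \<open>
  The algebras of the tower are indexed with a shift: \<open>T 0\<close> is \<open>\<B>\<close>, \<open>T 1\<close> is \<open>\<A>\<close>, and in general
  \<open>T (k + 1)\<close> is the \<open>k\<close>-th algebra of the tower. The projections and expectations are not shifted:
  \<open>e k\<close> (for \<open>k \<ge> 1\<close>) is the Jones projection in \<open>T (k + 1)\<close>, and \<open>E k\<close> maps \<open>T (k + 1)\<close> onto
  \<open>T k\<close>.
\<close>

definition jones_tower ::
    "'a::unital_cstar_algebra set \<Rightarrow> 'a set \<Rightarrow> ('a \<Rightarrow> 'a) \<Rightarrow>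
     (nat \<Rightarrow> 'a set) \<Rightarrow> (nat \<Rightarrow> 'a) \<Rightarrow> (nat \<Rightarrow> 'a \<Rightarrow> 'a) \<Rightarrow> bool" where
  "jones_tower A B E\<^sub>0 T e E \<longleftrightarrow>
     T 0 = B \<and> T 1 = A \<and> E 0 = E\<^sub>0 \<and>
     (\<forall>k. basic_construction (T (k + 1)) (E k) (T (k + 2)) (e (k + 1)) \<and>
          dual_expectation (T (k + 1)) (E k) (T (k + 2)) (e (k + 1)) (E (k + 1)))"

definition depth_condition ::
    "(nat \<Rightarrow> 'a::unital_cstar_algebra set) \<Rightarrow> (nat \<Rightarrow> 'a) \<Rightarrow> nat \<Rightarrow> bool" where
  "depth_condition T e k \<longleftrightarrow>
     rel_commutant (T 0) (T (k + 1)) =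
       cspan {x * e k * y | x y. x \<in> rel_commutant (T 0) (T k) \<and> y \<in> rel_commutant (T 0) (T k)}"

definition finite_depth ::
    "(nat \<Rightarrow> 'a::unital_cstar_algebra set) \<Rightarrow> (nat \<Rightarrow> 'a) \<Rightarrow> bool" where
  "finite_depth T e \<longleftrightarrow> (\<exists>k\<ge>1. depth_condition T e k)"

definition depth :: "(nat \<Rightarrow> 'a::unital_cstar_algebra set) \<Rightarrow> (nat \<Rightarrow> 'a) \<Rightarrow> nat" where
  "depth T e = (LEAST k. k \<ge> 1 \<and> depth_condition T e k)"

end

theory Submission
  imports Defs
begin

text \<open>
  The depth condition holds at level 2 because \<open>A\<close> has a basis over \<open>B\<close> of unitaries normalizing \<open>B\<close>.

  Let \<open>N\<close> be the group of these unitaries. By regularity its linear span is dense in \<open>A\<close>. By finite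
  index, \<open>A\<close> is a finitely generated left \<open>B\<close>-module, and generators of such a module may be perturbed
  into a dense subset (\<open>generators_in_dense_subset\<close>; the control on coefficients comes from Baire's
  theorem). Hence \<open>A\<close> is a finite sum of subspaces \<open>B u\<close> with \<open>u \<in> N\<close>. The coefficients that a
  fixed one of these unitaries has in the \<open>B\<close>-linear relations among them form a two-sided ideal of
  \<open>B\<close>, so by simplicity of \<open>B\<close> a minimal such family is independent. Its coordinate functionals have the form
  \<open>x \<mapsto> E (x v\<^sub>u)\<close>, and uniqueness of coordinates makes \<open>v\<^sub>u\<close> intertwine \<open>b\<close> with \<open>u b u*\<close>. Thus
  \<open>x = (\<Sum>u. u* E (p\<^sub>u x))\<close> with \<open>p\<^sub>u = v\<^sub>u*\<close> (\<open>normalizer_dual_basis\<close>).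

  Moving \<open>b \<in> B\<close> past \<open>u*\<close> turns it into \<open>u b u*\<close>, the Jones projection \<open>e\<close> commutes with that element,
  and both \<open>u\<close> and \<open>p\<^sub>u\<close> turn it back into \<open>b\<close>. So \<open>u* e u\<close> and \<open>u* e p\<^sub>u\<close> lie in the relative commutant of
  \<open>B\<close> in \<open>A\<^sub>1\<close>. Up to a factor which inverts the central element \<open>E\<^sub>1 e\<close> of \<open>A\<close>, these
  elements are a pair of dual bases of \<open>A\<^sub>1\<close> over \<open>A\<close> (\<open>regular_basic_construction_dual_basis\<close>).

  Finally let \<open>z \<in> A\<^sub>2\<close> commute with \<open>B\<close>. As a right \<open>A\<close>-linear operator on \<open>A\<^sub>1\<close> it is determined by its
  values on a basis: if \<open>x = (\<Sum>i. \<kappa>\<^sub>i E\<^sub>1 (\<mu>\<^sub>i x))\<close> on \<open>A\<^sub>1\<close>, then \<open>z = (\<Sum>i. z(\<kappa>\<^sub>i) e\<^sub>2 \<mu>\<^sub>i)\<close>. When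
  the \<open>\<kappa>\<^sub>i\<close> commute with \<open>B\<close>, so do the \<open>z(\<kappa>\<^sub>i)\<close>, and this is an expression of the required form
  (\<open>rel_commutant_eq_span\<close>).
\<close>

section \<open>Unital C*-subalgebras\<close>

lemma cstar_subalgebraD:
  assumes "unital_cstar_subalgebra A"
  shows "1 \<in> A" "0 \<in> A" "closed A"
    and "x \<in> A \<Longrightarrow> y \<in> A \<Longrightarrow> x + y \<in> A"
    and "x \<in> A \<Longrightarrow> y \<in> A \<Longrightarrow> x - y \<in> A"
    and "x \<in> A \<Longrightarrow> y \<in> A \<Longrightarrow> x * y \<in> A"
    and "x \<in> A \<Longrightarrow> scaleC c x \<in> A"
    and "x \<in> A \<Longrightarrow> scaleR r x \<in> A"
    and "x \<in> A \<Longrightarrow> - x \<in> A"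
    and "x \<in> A \<Longrightarrow> star x \<in> A"
proof -
  note Ad = assms[unfolded unital_cstar_subalgebra_def]
  show "1 \<in> A" "closed A" using Ad by blast+
  show "x + y \<in> A" if "x \<in> A" "y \<in> A" for x y using Ad that by blast
  show "x * y \<in> A" if "x \<in> A" "y \<in> A" for x y using Ad that by blast
  show sc: "scaleC c x \<in> A" if "x \<in> A" for c x using Ad that by blast
  show "star x \<in> A" if "x \<in> A" for x using Ad that by blast
  show "0 \<in> A" using sc[OF \<open>1 \<in> A\<close>, of 0] by simp
  show "scaleR r x \<in> A" if "x \<in> A" for r x using sc that by (simp add: scaleR_scaleC)
  show m: "- x \<in> A" if "x \<in> A" for x using sc[OF that, of "-1"] by simp
  show "x - y \<in> A" if "x \<in> A" "y \<in> A" for x y using Ad m[OF that(2)] that(1)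
    by (metis diff_conv_add_uminus)
qed

lemma cstar_subalgebra_sum:
  assumes "unital_cstar_subalgebra A" "\<And>i. i \<in> I \<Longrightarrow> f i \<in> A"
  shows "sum f I \<in> A"
  using assms(2)
  by (induction I rule: infinite_finite_induct)
     (auto intro: cstar_subalgebraD[OF assms(1)])

text \<open>
  The C*-identity gives \<open>\<parallel>x\<parallel>\<^sup>2 \<le> \<parallel>x*\<parallel> \<parallel>x\<parallel>\<close>, that is \<open>\<parallel>x\<parallel> \<le> \<parallel>x*\<parallel>\<close>; apply this to \<open>x*\<close> as well.
\<close>

lemma norm_star: "norm (star x) = norm (x :: 'a::unital_cstar_algebra)"
proof -
  have le: "norm y \<le> norm (star y)" for y :: 'a
  proof (cases "y = 0")
    case False
    have "norm y * norm y \<le> norm (star y) * norm y"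
      using cstar_identity[of y] norm_mult_ineq[of "star y" y] by (simp add: power2_eq_square)
    then show ?thesis using False by simp
  qed simp
  show ?thesis using le[of x] le[of "star x"] by (simp add: star_star)
qed

lemma continuous_on_star: "continuous_on S (star :: 'a::unital_cstar_algebra \<Rightarrow> 'a)"
  by (rule continuous_on_iff[THEN iffD2])
     (auto simp: dist_norm star_diff[symmetric] norm_star)

lemma continuous_on_scaleC:
  "continuous_on S (scaleC c :: 'a::unital_cstar_algebra \<Rightarrow> 'a)"
proof -
  have "continuous_on S (\<lambda>x :: 'a. scaleC c 1 * x)" by (intro continuous_intros)
  then show ?thesis by (simp add: mult_scaleC_left)
qed

lemma inj_star: "inj_on (star :: 'a::unital_cstar_algebra \<Rightarrow> 'a) S"
  by (metis inj_onI star_star)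

section \<open>Density of the span of the normalizer\<close>

lemma normalizerD:
  assumes "u \<in> normalizer A B"
  shows "u \<in> A" "star u * u = 1" "u * star u = 1"
    and "b \<in> B \<Longrightarrow> u * b * star u \<in> B" and "b \<in> B \<Longrightarrow> star u * b * u \<in> B"
proof -
  note N = assms[unfolded normalizer_def mem_Collect_eq]
  show "u \<in> A" and u: "star u * u = 1" "u * star u = 1" using N by blast+
  show "u * b * star u \<in> B" if "b \<in> B" using N that by blast
  show "star u * b * u \<in> B" if "b \<in> B"
  proof -
    have "b \<in> (\<lambda>b. u * b * star u) ` B" using N that by simp
    then obtain b' where "b' \<in> B" "b = u * b' * star u" by (rule imageE)
    moreover have "star u * (u * b' * star u) * u = (star u * u) * b' * (star u * u)"
      by (simp only: mult.assoc)
    ultimately show ?thesis by (simp add: u)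
  qed
qed

lemma normalizerI:
  assumes "u \<in> A" "star u * u = 1" "u * star u = 1"
    and "\<And>b. b \<in> B \<Longrightarrow> u * b * star u \<in> B" and "\<And>b. b \<in> B \<Longrightarrow> star u * b * u \<in> B"
  shows "u \<in> normalizer A B"
proof -
  have "b \<in> (\<lambda>b. u * b * star u) ` B" if "b \<in> B" for b
  proof (rule image_eqI[OF _ assms(5)[OF that]])
    have "u * (star u * b * u) * star u = (u * star u) * b * (u * star u)"
      by (simp only: mult.assoc)
    then show "b = u * (star u * b * u) * star u" by (simp add: assms)
  qed
  then show ?thesis unfolding normalizer_def using assms by auto
qed

lemma normalizer_one:
  assumes "unital_cstar_subalgebra A"
  shows "1 \<in> normalizer A B"
  by (rule normalizerI) (auto simp: star_one cstar_subalgebraD[OF assms])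

lemma normalizer_star:
  assumes "unital_cstar_subalgebra A" "u \<in> normalizer A B"
  shows "star u \<in> normalizer A B"
  by (rule normalizerI)
     (auto simp: star_star normalizerD[OF assms(2)] cstar_subalgebraD[OF assms(1)])

lemma normalizer_mult:
  assumes A: "unital_cstar_subalgebra A" and u: "u \<in> normalizer A B" and v: "v \<in> normalizer A B"
  shows "u * v \<in> normalizer A B"
proof (rule normalizerI)
  show "u * v \<in> A" by (intro cstar_subalgebraD[OF A] normalizerD[OF u] normalizerD[OF v])
  have "star (u * v) * (u * v) = star v * (star u * u) * v" by (simp only: star_mult mult.assoc)
  then show "star (u * v) * (u * v) = 1" by (simp add: normalizerD[OF u] normalizerD[OF v])
  have "u * v * star (u * v) = u * (v * star v) * star u" by (simp only: star_mult mult.assoc)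
  then show "u * v * star (u * v) = 1" by (simp add: normalizerD[OF u] normalizerD[OF v])
  fix b assume b: "b \<in> B"
  show "u * v * b * star (u * v) \<in> B"
    using normalizerD(4)[OF u normalizerD(4)[OF v b]] by (simp add: star_mult mult.assoc)
  show "star (u * v) * b * (u * v) \<in> B"
    using normalizerD(5)[OF v normalizerD(5)[OF u b]] by (simp add: star_mult mult.assoc)
qed

lemma closure_closed_under:
  assumes "continuous_on UNIV f" "\<And>x. x \<in> S \<Longrightarrow> f x \<in> closure S" "x \<in> closure S"
  shows "f x \<in> closure S"
proof -
  have "f ` closure S \<subseteq> closure S"
    by (rule image_closure_subset[OF continuous_on_subset[OF assms(1)]]) (use assms in auto)
  then show ?thesis using assms(3) by blast
qed

text \<open>
  As the normalizer is a group closed under the involution, its linear span is already a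
  *-algebra, and the closure of that span is the C*-algebra which it generates.
\<close>

lemma dense_span_normalizer:
  fixes A B :: "'a::unital_cstar_algebra set"
  assumes A: "unital_cstar_subalgebra A" and reg: "regular_inclusion A B"
  shows "A \<subseteq> closure (cspan (normalizer A B))"
proof -
  define D where "D = cspan (normalizer A B)"
  have D_mult: "x * y \<in> D" if "x \<in> D" "y \<in> D" for x y
  proof -
    have 1: "u * y \<in> D" if u: "u \<in> normalizer A B" for u
      using \<open>y \<in> D\<close> unfolding D_def
    proof (induction rule: cstar.span_induct_alt)
      case (step c v z)
      have "u * v \<in> cspan (normalizer A B)"
        by (intro cstar.span_base normalizer_mult[OF A u] step)
      then show ?case using step
        by (simp add: distrib_left mult_scaleC_right cstar.span_add cstar.span_scale)
    qed (auto simp: cstar.span_zero)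
    show ?thesis using \<open>x \<in> D\<close> unfolding D_def
    proof (induction rule: cstar.span_induct_alt)
      case (step c v z)
      then show ?case using 1[unfolded D_def]
        by (simp add: distrib_right mult_scaleC_left cstar.span_add cstar.span_scale)
    qed (auto simp: cstar.span_zero)
  qed
  have D_star: "star x \<in> D" if "x \<in> D" for x
    using that unfolding D_def
  proof (induction rule: cstar.span_induct_alt)
    case (step c v z)
    then show ?case
      by (simp add: star_add star_scaleC cstar.span_add cstar.span_scale cstar.span_base
          normalizer_star[OF A])
  qed (auto simp: star_zero cstar.span_zero)
  have D_sub: "x \<in> closure D" if "x \<in> D" for x using that closure_subset by blast
  have "unital_cstar_subalgebra (closure D)"
    unfolding unital_cstar_subalgebra_def
  proof (intro conjI ballI allI)
    show "1 \<in> closure D" unfolding D_def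
      using normalizer_one[OF A, of B] cstar.span_base closure_subset by blast
    show "closed (closure D)" by simp
    show "scaleC c x \<in> closure D" if "x \<in> closure D" for c x
      by (rule closure_closed_under[OF continuous_on_scaleC _ that])
         (auto simp: D_def intro!: D_sub[unfolded D_def] cstar.span_scale)
    show "star x \<in> closure D" if "x \<in> closure D" for x
      by (rule closure_closed_under[OF continuous_on_star _ that]) (auto intro: D_sub D_star)
    fix x y assume x: "x \<in> closure D" and y: "y \<in> closure D"
    have "a + y \<in> closure D" if "a \<in> D" for a
      by (rule closure_closed_under[OF _ _ y, of "\<lambda>y. a + y"])
         (use that in \<open>auto simp: D_def intro!: continuous_intros D_sub[unfolded D_def] cstar.span_add\<close>)
    then show "x + y \<in> closure D"
      by (intro closure_closed_under[OF _ _ x, of "\<lambda>x. x + y"]) (auto intro!: continuous_intros)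
    have "a * y \<in> closure D" if "a \<in> D" for a
      by (rule closure_closed_under[OF _ _ y, of "\<lambda>y. a * y"])
         (use that in \<open>auto intro!: continuous_intros D_sub D_mult\<close>)
    then show "x * y \<in> closure D"
      by (intro closure_closed_under[OF _ _ x, of "\<lambda>x. x * y"]) (auto intro!: continuous_intros)
  qed
  moreover have "normalizer A B \<subseteq> closure D"
    unfolding D_def using cstar.span_base closure_subset by blast
  ultimately have "unital_cstar_subalgebra hull (normalizer A B) \<subseteq> closure D"
    by (intro hull_minimal)
  then show ?thesis using reg unfolding regular_inclusion_def D_def by simp
qed

section \<open>Finitely generated modules and dense subspaces\<close>

text \<open>
  \<open>A\<close> is the countable union of the closures of the sets \<open>G k\<close> of combinations with coefficients of
  norm at most \<open>k\<close>. By Baire's theorem one of these closures contains a ball of \<open>A\<close>, and subtracting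
  its centre moves that ball to the origin at the cost of doubling the bound.
\<close>

lemma bounded_coefficients_approximate:
  fixes A B :: "'a::unital_cstar_algebra set"
  assumes A: "unital_cstar_subalgebra A" and B: "unital_cstar_subalgebra B" and BA: "B \<subseteq> A"
    and S: "S \<subseteq> A"
    and gen: "\<And>x. x \<in> A \<Longrightarrow> \<exists>b. (\<forall>s\<in>S. b s \<in> B) \<and> x = (\<Sum>s\<in>S. b s * s)"
    and fin: "finite S"
  obtains r :: real and K :: real where "r > 0" "K > 0"
    "\<And>x \<epsilon>. x \<in> A \<Longrightarrow> norm x < r \<Longrightarrow> \<epsilon> > 0 \<Longrightarrow>
      \<exists>b. (\<forall>s\<in>S. b s \<in> B \<and> norm (b s) \<le> K) \<and> norm (x - (\<Sum>s\<in>S. b s * s)) < \<epsilon>"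
proof -
  define G where "G k = {(\<Sum>s\<in>S. b s * s) | b. \<forall>s\<in>S. b s \<in> B \<and> norm (b s) \<le> real k}" for k
  have sumA: "(\<Sum>s\<in>S. b s * s) \<in> A" if "\<And>s. s \<in> S \<Longrightarrow> b s \<in> B" for b
    using that BA S by (intro cstar_subalgebra_sum[OF A] cstar_subalgebraD[OF A]) auto
  have "G k \<subseteq> A" for k unfolding G_def using sumA by auto
  then have clA: "closure (G k) \<subseteq> A" for k
    by (simp add: closure_minimal cstar_subalgebraD(3)[OF A])
  have union: "(\<Union>k. closure (G k)) = A"
  proof
    show "A \<subseteq> (\<Union>k. closure (G k))"
    proof
      fix x assume "x \<in> A"
      then obtain b where b: "\<forall>s\<in>S. b s \<in> B" "x = (\<Sum>s\<in>S. b s * s)" using gen by blast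
      obtain k :: nat where k: "(\<Sum>s\<in>S. norm (b s)) \<le> real k" using real_arch_simple by blast
      have "norm (b s) \<le> real k" if "s \<in> S" for s
        using k member_le_sum[of s S "\<lambda>s. norm (b s)"] fin that by simp
      then have "x \<in> G k" unfolding G_def using b by auto
      then show "x \<in> (\<Union>k. closure (G k))" using closure_subset by blast
    qed
  qed (use clA in blast)
  have "\<exists>k. top_of_set A interior_of closure (G k) \<noteq> {}"
  proof (rule ccontr)
    assume *: "\<not> ?thesis"
    have cm: "completely_metrizable_space (top_of_set A)"
      using completely_metrizable_space_closedin completely_metrizable_space_euclidean
        cstar_subalgebraD(3)[OF A] closed_closedin by blast
    have "top_of_set A interior_of \<Union>(range (\<lambda>k. closure (G k))) = {}"
    proof (rule Baire_category_alt)
      show "closedin (top_of_set A) Z \<and> top_of_set A interior_of Z = {}"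
        if "Z \<in> range (\<lambda>k. closure (G k))" for Z
        using that * closed_subset[OF clA closed_closure] by blast
    qed (use cm in auto)
    then have "top_of_set A interior_of A = {}" using union by simp
    moreover have "top_of_set A interior_of A = A"
      using interior_of_topspace[of "top_of_set A"] by simp
    ultimately show False using cstar_subalgebraD(1)[OF A] by simp
  qed
  then obtain k a where a: "a \<in> top_of_set A interior_of closure (G k)" by blast
  have "openin (top_of_set A) (top_of_set A interior_of closure (G k))"
    by (rule openin_interior_of)
  then obtain r where aA: "a \<in> A" and r: "r > 0"
    and ball: "\<And>y. y \<in> A \<Longrightarrow> dist y a < r \<Longrightarrow> y \<in> top_of_set A interior_of closure (G k)"
    unfolding openin_euclidean_subtopology_iff using a by blast
  have ball': "y \<in> closure (G k)" if "y \<in> A" "dist y a < r" for y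
    using ball[OF that] interior_of_subset by fast
  show ?thesis
  proof (rule that[OF r])
    \<comment> \<open>The summand 1 only makes the bound strictly positive when \<open>k = 0\<close>.\<close>
    show "0 < 2 * real k + 1" by simp
    fix x :: 'a and \<epsilon> :: real assume x: "x \<in> A" "norm x < r" and \<epsilon>: "\<epsilon> > 0"
    have "a + x \<in> closure (G k)" "a \<in> closure (G k)"
      using ball'[of "a + x"] ball'[of a] x aA r cstar_subalgebraD(4)[OF A] by (auto simp: dist_norm)
    then obtain g h where g: "g \<in> G k" "dist g (a + x) < \<epsilon> / 2" and h: "h \<in> G k" "dist h a < \<epsilon> / 2"
      unfolding closure_approachable using \<epsilon> half_gt_zero by meson
    obtain bg bh where bg: "\<forall>s\<in>S. bg s \<in> B \<and> norm (bg s) \<le> real k" "g = (\<Sum>s\<in>S. bg s * s)"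
      and bh: "\<forall>s\<in>S. bh s \<in> B \<and> norm (bh s) \<le> real k" "h = (\<Sum>s\<in>S. bh s * s)"
      using g(1) h(1) unfolding G_def by blast
    show "\<exists>b. (\<forall>s\<in>S. b s \<in> B \<and> norm (b s) \<le> 2 * real k + 1) \<and> norm (x - (\<Sum>s\<in>S. b s * s)) < \<epsilon>"
    proof (intro exI[of _ "\<lambda>s. bg s - bh s"] conjI ballI)
      fix s assume s: "s \<in> S"
      show "bg s - bh s \<in> B" using bg bh s cstar_subalgebraD(5)[OF B] by blast
      have "norm (bg s) \<le> real k" "norm (bh s) \<le> real k" using bg bh s by auto
      then show "norm (bg s - bh s) \<le> 2 * real k + 1"
        using norm_triangle_ineq4[of "bg s" "bh s"] by linarith
    next
      have "x - (\<Sum>s\<in>S. (bg s - bh s) * s) = (h - a) - (g - (a + x))"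
        by (simp add: bg(2) bh(2) left_diff_distrib sum_subtractf)
      also have "norm \<dots> \<le> norm (h - a) + norm (g - (a + x))" by (rule norm_triangle_ineq4)
      also have "\<dots> < \<epsilon>" using g h by (simp add: dist_norm)
      finally show "norm (x - (\<Sum>s\<in>S. (bg s - bh s) * s)) < \<epsilon>" .
    qed
  qed
qed

text \<open>
  Replacing each generator \<open>s\<close> by some \<open>d s \<in> D\<close> so close to it that bounded combinations change
  little, every \<open>x\<close> in a ball is a combination of the new generators up to an error of half the
  radius. Rescaling the error and iterating gives coefficients as geometrically convergent series,
  whose sums stay in \<open>B\<close> because \<open>B\<close> is closed.
\<close>

lemma generators_in_dense_subset:
  fixes A B D :: "'a::unital_cstar_algebra set"
  assumes A: "unital_cstar_subalgebra A" and B: "unital_cstar_subalgebra B" and BA: "B \<subseteq> A"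
    and S: "S \<subseteq> A" and fin: "finite S"
    and gen: "\<And>x. x \<in> A \<Longrightarrow> \<exists>b. (\<forall>s\<in>S. b s \<in> B) \<and> x = (\<Sum>s\<in>S. b s * s)"
    and DA: "D \<subseteq> A" and dense: "A \<subseteq> closure D"
  obtains d where "\<And>s. s \<in> S \<Longrightarrow> d s \<in> D"
    and "\<And>x. x \<in> A \<Longrightarrow> \<exists>b. (\<forall>s\<in>S. b s \<in> B) \<and> x = (\<Sum>s\<in>S. b s * d s)"
proof -
  obtain r K :: real where r: "r > 0" and K: "K > 0"
    and approx: "\<And>x \<epsilon>. x \<in> A \<Longrightarrow> norm x < r \<Longrightarrow> \<epsilon> > 0 \<Longrightarrow>
      \<exists>b. (\<forall>s\<in>S. b s \<in> B \<and> norm (b s) \<le> K) \<and> norm (x - (\<Sum>s\<in>S. b s * s)) < \<epsilon>"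
    by (rule bounded_coefficients_approximate[OF A B BA S gen fin]) blast+
  define \<eta> where "\<eta> = r / (4 * K * (real (card S) + 1))"
  have \<eta>: "\<eta> > 0" unfolding \<eta>_def using r K by simp
  have "\<exists>d. d \<in> D \<and> norm (s - d) < \<eta>" if "s \<in> S" for s
  proof -
    have "s \<in> closure D" using that S dense by blast
    then show ?thesis unfolding closure_approachable using \<eta> by (auto simp: dist_norm norm_minus_commute)
  qed
  then obtain d where d: "\<And>s. s \<in> S \<Longrightarrow> d s \<in> D" "\<And>s. s \<in> S \<Longrightarrow> norm (s - d s) < \<eta>"
    by metis
  have dA: "(\<Sum>s\<in>S. b s * d s) \<in> A" if "\<And>s. s \<in> S \<Longrightarrow> b s \<in> B" for b
    using that BA d(1) DA by (intro cstar_subalgebra_sum[OF A] cstar_subalgebraD[OF A]) auto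
  have half: "\<exists>b. (\<forall>s\<in>S. b s \<in> B \<and> norm (b s) \<le> K) \<and> norm (x - (\<Sum>s\<in>S. b s * d s)) < r / 2"
    if x: "x \<in> A" "norm x < r" for x
  proof -
    obtain b where b: "\<forall>s\<in>S. b s \<in> B \<and> norm (b s) \<le> K"
      and bx: "norm (x - (\<Sum>s\<in>S. b s * s)) < r / 4"
      using approx[OF x, of "r / 4"] r by auto
    have "norm (\<Sum>s\<in>S. b s * (s - d s)) \<le> (\<Sum>s\<in>S. K * \<eta>)"
    proof (rule sum_norm_le)
      fix s assume s: "s \<in> S"
      have "norm (b s * (s - d s)) \<le> norm (b s) * norm (s - d s)" by (rule norm_mult_ineq)
      also have "\<dots> \<le> K * \<eta>" using b d(2)[OF s] s K by (intro mult_mono) auto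
      finally show "norm (b s * (s - d s)) \<le> K * \<eta>" .
    qed
    also have "(\<Sum>s\<in>S. K * \<eta>) = r / 4 * (real (card S) / (real (card S) + 1))"
      using K by (simp add: \<eta>_def)
    also have "\<dots> \<le> r / 4 * 1" using r by (intro mult_left_mono) auto
    also have "\<dots> = r / 4" by simp
    finally have 2: "norm (\<Sum>s\<in>S. b s * (s - d s)) \<le> r / 4" .
    have "x - (\<Sum>s\<in>S. b s * d s) = (x - (\<Sum>s\<in>S. b s * s)) + (\<Sum>s\<in>S. b s * (s - d s))"
      by (simp add: right_diff_distrib sum_subtractf)
    also have "norm \<dots> \<le> norm (x - (\<Sum>s\<in>S. b s * s)) + norm (\<Sum>s\<in>S. b s * (s - d s))"
      by (rule norm_triangle_ineq)
    also have "\<dots> < r / 2" using bx 2 by simp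
    finally show ?thesis using b by blast
  qed
  then have "\<forall>x\<in>{x \<in> A. norm x < r}. \<exists>b. (\<forall>s\<in>S. b s \<in> B \<and> norm (b s) \<le> K) \<and>
      norm (x - (\<Sum>s\<in>S. b s * d s)) < r / 2" by blast
  from bchoice[OF this] obtain \<beta> where
      \<beta>: "\<And>x s. x \<in> A \<Longrightarrow> norm x < r \<Longrightarrow> s \<in> S \<Longrightarrow> \<beta> x s \<in> B \<and> norm (\<beta> x s) \<le> K"
      "\<And>x. x \<in> A \<Longrightarrow> norm x < r \<Longrightarrow> norm (x - (\<Sum>s\<in>S. \<beta> x s * d s)) < r / 2"
    by blast
  have small: "\<exists>b. (\<forall>s\<in>S. b s \<in> B) \<and> x = (\<Sum>s\<in>S. b s * d s)" if x: "x \<in> A" "norm x < r" for x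
  proof -
    \<comment> \<open>\<open>y n\<close> is the error after \<open>n\<close> steps, magnified by \<open>2 ^ n\<close> so as to lie in the ball again.\<close>
    define y where "y = rec_nat x (\<lambda>_ y. 2 *\<^sub>R (y - (\<Sum>s\<in>S. \<beta> y s * d s)))"
    have y0: "y 0 = x" and ySuc: "y (Suc n) = 2 *\<^sub>R (y n - (\<Sum>s\<in>S. \<beta> (y n) s * d s))" for n
      unfolding y_def by simp_all
    have y: "y n \<in> A \<and> norm (y n) < r" for n
    proof (induction n)
      case (Suc n)
      then show ?case unfolding ySuc
        using \<beta>(1)[of "y n"] \<beta>(2)[of "y n"]
        by (auto intro!: cstar_subalgebraD(5,8)[OF A] dA)
    qed (use x y0 in simp)
    define p where "p n s = (1/2) ^ n *\<^sub>R \<beta> (y n) s" for n s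
    have pB: "p n s \<in> B" if "s \<in> S" for n s
      unfolding p_def using \<beta>(1) y that by (intro cstar_subalgebraD(8)[OF B]) auto
    have sm: "summable (\<lambda>n. p n s)" if "s \<in> S" for s
    proof (rule summable_comparison_test'[where N = 0])
      show "summable (\<lambda>n. K * (1/2 :: real) ^ n)" by (intro summable_mult summable_geometric) simp
      show "norm (p n s) \<le> K * (1/2) ^ n" for n
        unfolding p_def using \<beta>(1)[of "y n" s] y[of n] that by (simp add: divide_simps)
    qed
    define b where "b s = (\<Sum>n. p n s)" for s
    have b_sums: "(\<lambda>n. p n s) sums b s" if "s \<in> S" for s unfolding b_def using sm[OF that] by (rule summable_sums)
    have bB: "b s \<in> B" if "s \<in> S" for s
    proof (rule closed_sequentially[OF cstar_subalgebraD(3)[OF B]])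
      show "(\<lambda>N. \<Sum>n<N. p n s) \<longlonglongrightarrow> b s" using b_sums[OF that] by (simp add: sums_def)
      show "(\<Sum>n<N. p n s) \<in> B" for N using pB[OF that] by (intro cstar_subalgebra_sum[OF B])
    qed
    have rem: "x = (\<Sum>s\<in>S. (\<Sum>n<N. p n s) * d s) + (1/2) ^ N *\<^sub>R y N" for N
    proof (induction N)
      case (Suc N)
      have "(1/2) ^ N *\<^sub>R y N = (\<Sum>s\<in>S. p N s * d s) + (1/2) ^ Suc N *\<^sub>R y (Suc N)"
        by (simp add: p_def ySuc scaleR_diff_right scaleR_sum_right)
      then show ?case by (subst Suc.IH) (simp add: distrib_right sum.distrib)
    qed (simp add: y0)
    have lim1: "(\<lambda>N. \<Sum>s\<in>S. (\<Sum>n<N. p n s) * d s) \<longlonglongrightarrow> (\<Sum>s\<in>S. b s * d s)"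
      using b_sums unfolding sums_def by (intro tendsto_intros) auto
    have lim2: "(\<lambda>N. (1/2) ^ N *\<^sub>R y N) \<longlonglongrightarrow> 0"
    proof (rule Lim_null_comparison)
      show "\<forall>\<^sub>F N in sequentially. norm ((1/2) ^ N *\<^sub>R y N) \<le> r * (1/2) ^ N"
        using y[THEN conjunct2, THEN less_imp_le]
        by (intro always_eventually allI) (simp add: divide_simps)
      show "(\<lambda>N. r * (1/2) ^ N) \<longlonglongrightarrow> 0"
        by (intro tendsto_mult_right_zero LIMSEQ_realpow_zero) auto
    qed
    have "(\<lambda>N. x) \<longlonglongrightarrow> (\<Sum>s\<in>S. b s * d s)"
      using tendsto_add[OF lim1 lim2] rem by (simp flip: rem)
    then have "x = (\<Sum>s\<in>S. b s * d s)" using LIMSEQ_unique tendsto_const by blast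
    then show ?thesis using bB by blast
  qed
  have "\<exists>b. (\<forall>s\<in>S. b s \<in> B) \<and> x = (\<Sum>s\<in>S. b s * d s)" if x: "x \<in> A" for x
  proof -
    define t where "t = r / (2 * (norm x + 1))"
    have t: "t > 0" unfolding t_def using r by (simp add: add_nonneg_pos)
    have "norm (t *\<^sub>R x) = t * norm x" using t by simp
    also have "\<dots> = r * (norm x / (2 * (norm x + 1)))" by (simp add: t_def)
    also have "\<dots> < r * 1"
      using r norm_ge_zero[of x] by (intro mult_strict_left_mono) (simp_all add: divide_less_eq add_nonneg_pos)
    finally have "norm (t *\<^sub>R x) < r" by simp
    then obtain b where b: "\<forall>s\<in>S. b s \<in> B" "t *\<^sub>R x = (\<Sum>s\<in>S. b s * d s)"
      using small[of "t *\<^sub>R x"] cstar_subalgebraD(8)[OF A x] by blast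
    have "x = inverse t *\<^sub>R (t *\<^sub>R x)" using t by simp
    also have "\<dots> = (\<Sum>s\<in>S. (inverse t *\<^sub>R b s) * d s)" unfolding b(2) by (simp add: scaleR_sum_right)
    finally show ?thesis using b(1) cstar_subalgebraD(8)[OF B] by (intro exI[of _ "\<lambda>s. inverse t *\<^sub>R b s"]) auto
  qed
  with d(1) show ?thesis using that by blast
qed

definition left_span :: "'a::unital_cstar_algebra set \<Rightarrow> 'a set \<Rightarrow> 'a set" where
  "left_span B S = {\<Sum>s\<in>S. b s * s | b. \<forall>s\<in>S. b s \<in> B}"

lemma left_spanI:
  "(\<And>s. s \<in> S \<Longrightarrow> b s \<in> B) \<Longrightarrow> x = (\<Sum>s\<in>S. b s * s) \<Longrightarrow> x \<in> left_span B S"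
  unfolding left_span_def by blast

lemma left_spanE:
  assumes "x \<in> left_span B S"
  obtains b where "\<And>s. s \<in> S \<Longrightarrow> b s \<in> B" "x = (\<Sum>s\<in>S. b s * s)"
  using assms unfolding left_span_def by blast

lemma left_span_combination:
  assumes B: "unital_cstar_subalgebra B"
    and b: "\<And>i. i \<in> I \<Longrightarrow> b i \<in> B" and x: "\<And>i. i \<in> I \<Longrightarrow> x i \<in> left_span B S"
  shows "(\<Sum>i\<in>I. b i * x i) \<in> left_span B S"
proof -
  have "\<forall>i\<in>I. \<exists>c. (\<forall>s\<in>S. c s \<in> B) \<and> x i = (\<Sum>s\<in>S. c s * s)"
    using x unfolding left_span_def by blast
  from bchoice[OF this] obtain c where
    c: "\<And>i s. i \<in> I \<Longrightarrow> s \<in> S \<Longrightarrow> c i s \<in> B" "\<And>i. i \<in> I \<Longrightarrow> x i = (\<Sum>s\<in>S. c i s * s)"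
    by blast
  show ?thesis
  proof (rule left_spanI)
    show "(\<Sum>i\<in>I. b i * c i s) \<in> B" if "s \<in> S" for s
      using b c(1) that by (intro cstar_subalgebra_sum[OF B] cstar_subalgebraD(6)[OF B])
    have "(\<Sum>i\<in>I. b i * x i) = (\<Sum>i\<in>I. \<Sum>s\<in>S. b i * c i s * s)"
      using c(2) by (intro sum.cong) (simp_all add: sum_distrib_left mult.assoc)
    then show "(\<Sum>i\<in>I. b i * x i) = (\<Sum>s\<in>S. (\<Sum>i\<in>I. b i * c i s) * s)"
      by (subst (asm) sum.swap) (simp add: sum_distrib_right)
  qed
qed

lemma left_span_mono:
  assumes B: "unital_cstar_subalgebra B" and "S \<subseteq> S'" "finite S'"
  shows "left_span B S \<subseteq> left_span B S'"
proof
  fix x assume "x \<in> left_span B S"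
  then obtain b where b: "\<And>s. s \<in> S \<Longrightarrow> b s \<in> B" "x = (\<Sum>s\<in>S. b s * s)" by (rule left_spanE) blast
  show "x \<in> left_span B S'"
  proof (rule left_spanI)
    show "(if s \<in> S then b s else 0) \<in> B" for s using b(1) cstar_subalgebraD(2)[OF B] by simp
    show "x = (\<Sum>s\<in>S'. (if s \<in> S then b s else 0) * s)"
      unfolding b(2) using assms by (intro sum.mono_neutral_cong_left) auto
  qed
qed

lemma left_span_base:
  assumes B: "unital_cstar_subalgebra B" and "finite S" "s \<in> S"
  shows "s \<in> left_span B S"
proof -
  have "s \<in> left_span B {s}"
    by (rule left_spanI[of _ "\<lambda>_. 1"]) (simp_all add: cstar_subalgebraD(1)[OF B])
  then show ?thesis using left_span_mono[OF B, of "{s}" S] assms by blast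
qed

section \<open>Conditional expectations\<close>

lemma conditional_expectationD:
  assumes "conditional_expectation A B E"
  shows "x \<in> A \<Longrightarrow> E x \<in> B" and "b \<in> B \<Longrightarrow> E b = b"
    and "x \<in> A \<Longrightarrow> y \<in> A \<Longrightarrow> E (x + y) = E x + E y"
    and "b \<in> B \<Longrightarrow> x \<in> A \<Longrightarrow> E (b * x) = b * E x"
    and "b \<in> B \<Longrightarrow> x \<in> A \<Longrightarrow> E (x * b) = E x * b"
  using assms unfolding conditional_expectation_def by blast+

lemma conditional_expectation_sum:
  assumes A: "unital_cstar_subalgebra A" and B: "unital_cstar_subalgebra B"
    and E: "conditional_expectation A B E" and f: "\<And>i. i \<in> I \<Longrightarrow> f i \<in> A"
  shows "E (\<Sum>i\<in>I. f i) = (\<Sum>i\<in>I. E (f i))"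
proof -
  have E0: "E 0 = 0" using conditional_expectationD(2)[OF E] cstar_subalgebraD(2)[OF B] by blast
  show ?thesis using f
    by (induction I rule: infinite_finite_induct)
       (auto simp: E0 conditional_expectationD(3)[OF E] cstar_subalgebra_sum[OF A])
qed

text \<open>
  Expand \<open>z*\<close> in the quasi-basis: its coefficients \<open>E (z* l)\<close> are the adjoints of \<open>E (l* z)\<close>.
\<close>

lemma quasi_basis_expectation_faithful:
  assumes A: "unital_cstar_subalgebra A" and E: "conditional_expectation A B E"
    and L: "quasi_basis A E \<Lambda>" and z: "z \<in> A" and null: "\<And>x. x \<in> A \<Longrightarrow> E (x * z) = 0"
  shows "z = 0"
proof -
  have "E (star z * l) = 0" if "l \<in> \<Lambda>" for l
  proof -
    have l: "star l \<in> A" "l \<in> A"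
      using that L cstar_subalgebraD(10)[OF A] unfolding quasi_basis_def by auto
    have "E (star z * l) = E (star (star l * z))" by (simp add: star_mult star_star)
    also have "\<dots> = star (E (star l * z))"
      by (intro conditional_expectation_star[OF A E] cstar_subalgebraD(6)[OF A] l z)
    finally show ?thesis by (simp add: null l star_zero)
  qed
  moreover have "star z = (\<Sum>l\<in>\<Lambda>. E (star z * l) * star l)"
    using L cstar_subalgebraD(10)[OF A z] unfolding quasi_basis_def by blast
  ultimately have "star z = 0" by simp
  then show ?thesis by (metis star_star star_zero)
qed

section \<open>A finite basis of normalizing unitaries\<close>

text \<open>
  The adjoints of a quasi-basis generate \<open>A\<close> over \<open>B\<close>. They may be replaced by elements of the linear
  span of the normalizer, and each of these involves only finitely many unitaries.
\<close>

lemma regular_inclusion_finitely_generated: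
  assumes A: "unital_cstar_subalgebra A" and B: "unital_cstar_subalgebra B" and BA: "B \<subseteq> A"
    and reg: "regular_inclusion A B" and E: "conditional_expectation A B E"
    and L: "quasi_basis A E \<Lambda>"
  obtains F where "finite F" "F \<subseteq> normalizer A B" "A \<subseteq> left_span B F"
proof -
  have LA: "finite \<Lambda>" "\<Lambda> \<subseteq> A" using L unfolding quasi_basis_def by auto
  define N where "N = normalizer A B"
  have NA: "cspan N \<subseteq> A"
  proof
    fix x assume "x \<in> cspan N"
    then show "x \<in> A"
      by (induction rule: cstar.span_induct_alt)
         (auto simp: N_def intro: normalizerD(1) cstar_subalgebraD[OF A])
  qed
  have gen: "\<exists>b. (\<forall>s\<in>star ` \<Lambda>. b s \<in> B) \<and> x = (\<Sum>s\<in>star ` \<Lambda>. b s * s)" if x: "x \<in> A" for x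
  proof (intro exI[of _ "\<lambda>s. E (x * star s)"] conjI ballI)
    show "E (x * star s) \<in> B" if "s \<in> star ` \<Lambda>" for s
      using that x LA
      by (auto simp: star_star intro!: conditional_expectationD(1)[OF E] cstar_subalgebraD(6)[OF A])
    have "x = (\<Sum>l\<in>\<Lambda>. E (x * l) * star l)" using L x unfolding quasi_basis_def by blast
    then show "x = (\<Sum>s\<in>star ` \<Lambda>. E (x * star s) * s)"
      by (simp add: sum.reindex[OF inj_star] star_star)
  qed
  obtain d where dN: "\<And>s. s \<in> star ` \<Lambda> \<Longrightarrow> d s \<in> cspan N"
    and dgen: "\<And>x. x \<in> A \<Longrightarrow> \<exists>b. (\<forall>s\<in>star ` \<Lambda>. b s \<in> B) \<and> x = (\<Sum>s\<in>star ` \<Lambda>. b s * d s)"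
  proof (rule generators_in_dense_subset[OF A B BA _ _ gen NA])
    show "A \<subseteq> closure (cspan N)" unfolding N_def by (rule dense_span_normalizer[OF A reg])
    show "star ` \<Lambda> \<subseteq> A" using LA cstar_subalgebraD(10)[OF A] by blast
    show "finite (star ` \<Lambda>)" using LA by simp
  qed blast+
  have "\<exists>F. finite F \<and> F \<subseteq> N \<and> d s \<in> left_span B F" if s: "s \<in> star ` \<Lambda>" for s
  proof -
    obtain F r where F: "finite F" "F \<subseteq> N" and ds: "d s = (\<Sum>u\<in>F. scaleC (r u) u)"
      using dN[OF s] unfolding cstar.span_explicit by blast
    have "d s \<in> left_span B F"
      by (rule left_spanI[of _ "\<lambda>u. scaleC (r u) 1"])
         (simp_all add: ds mult_scaleC_left cstar_subalgebraD(1,7)[OF B])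
    then show ?thesis using F by blast
  qed
  then have "\<forall>s\<in>star ` \<Lambda>. \<exists>F. finite F \<and> F \<subseteq> N \<and> d s \<in> left_span B F" by blast
  from bchoice[OF this] obtain G where
    G: "\<And>s. s \<in> star ` \<Lambda> \<Longrightarrow> finite (G s) \<and> G s \<subseteq> N \<and> d s \<in> left_span B (G s)"
    by blast
  define F where "F = (\<Union>s\<in>star ` \<Lambda>. G s)"
  have F: "finite F" "F \<subseteq> N" unfolding F_def using G LA(1) by auto
  have dF: "d s \<in> left_span B F" if "s \<in> star ` \<Lambda>" for s
    using G[OF that] left_span_mono[OF B _ F(1), of "G s"] that unfolding F_def by blast
  have "A \<subseteq> left_span B F"
  proof
    fix x assume "x \<in> A"
    then obtain b where b: "\<forall>s\<in>star ` \<Lambda>. b s \<in> B" "x = (\<Sum>s\<in>star ` \<Lambda>. b s * d s)" using dgen by blast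
    show "x \<in> left_span B F" unfolding b(2) by (rule left_span_combination[OF B]) (use b(1) dF in auto)
  qed
  with F show ?thesis unfolding N_def by (rule that)
qed

text \<open>The inverse is the Neumann series of \<open>1 - j\<close>, which converges in the closed subalgebra \<open>B\<close>.\<close>

lemma right_inverse_near_one:
  fixes j :: "'a::unital_cstar_algebra"
  assumes B: "unital_cstar_subalgebra B" and j: "j \<in> B" "norm (1 - j) < 1"
  obtains g where "g \<in> B" "j * g = 1"
proof -
  define x where "x = 1 - j"
  have xB: "x ^ n \<in> B" for n
  proof (induction n)
    case (Suc n)
    have "x \<in> B" unfolding x_def using cstar_subalgebraD[OF B] j by blast
    then show ?case using Suc cstar_subalgebraD(6)[OF B] by simp
  qed (simp add: cstar_subalgebraD(1)[OF B])
  have sm: "summable (\<lambda>n. x ^ n)"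
    by (rule complete_algebra_summable_geometric) (use j x_def in simp)
  define g where "g = (\<Sum>n. x ^ n)"
  have "(\<lambda>N. \<Sum>n<N. x ^ n) \<longlonglongrightarrow> g" unfolding g_def using summable_LIMSEQ[OF sm] .
  then have "g \<in> B"
    by (rule closed_sequentially[OF cstar_subalgebraD(3)[OF B], rotated])
       (intro cstar_subalgebra_sum[OF B] xB)
  moreover have "x * g = g - 1"
    using suminf_mult[OF sm, of x] suminf_split_head[OF sm] by (simp add: g_def)
  then have "j * g = 1" unfolding x_def by (simp add: left_diff_distrib)
  ultimately show ?thesis by (rule that)
qed

text \<open>
  Simplicity speaks of closed ideals only. The closure of a nonzero algebraic ideal is all of \<open>B\<close>, so
  the ideal comes arbitrarily close to \<open>1\<close> and therefore contains an invertible element.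
\<close>

lemma simple_ideal_contains_one:
  fixes B :: "'a::unital_cstar_algebra set"
  assumes B: "unital_cstar_subalgebra B" and simple: "simple_cstar B"
    and JB: "J \<subseteq> B" and add: "\<And>x y. x \<in> J \<Longrightarrow> y \<in> J \<Longrightarrow> x + y \<in> J"
    and left: "\<And>b x. b \<in> B \<Longrightarrow> x \<in> J \<Longrightarrow> b * x \<in> J"
    and right: "\<And>b x. b \<in> B \<Longrightarrow> x \<in> J \<Longrightarrow> x * b \<in> J"
    and ne: "a \<in> J" "a \<noteq> 0"
  shows "1 \<in> J"
proof -
  have sub: "x \<in> closure J" if "x \<in> J" for x using that closure_subset by blast
  have "closed_two_sided_ideal B (closure J)"
    unfolding closed_two_sided_ideal_def
  proof (intro conjI ballI)
    show "closure J \<subseteq> B" by (rule closure_minimal[OF JB cstar_subalgebraD(3)[OF B]])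
    have "0 * a \<in> J" by (intro left ne cstar_subalgebraD(2)[OF B])
    then show "0 \<in> closure J" using sub by simp
    show "x + y \<in> closure J" if x: "x \<in> closure J" and y: "y \<in> closure J" for x y
    proof -
      have "z + y \<in> closure J" if "z \<in> J" for z
        by (rule closure_closed_under[OF _ _ y, of "\<lambda>y. z + y"])
           (use that in \<open>auto intro!: continuous_intros sub add\<close>)
      then show ?thesis
        by (intro closure_closed_under[OF _ _ x, of "\<lambda>x. x + y"]) (auto intro!: continuous_intros)
    qed
    show "b * x \<in> closure J" if "b \<in> B" "x \<in> closure J" for b x
      by (rule closure_closed_under[OF _ _ that(2), of "\<lambda>x. b * x"])
         (use that in \<open>auto intro!: continuous_intros sub left\<close>)
    show "x * b \<in> closure J" if "b \<in> B" "x \<in> closure J" for b x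
      by (rule closure_closed_under[OF _ _ that(2), of "\<lambda>x. x * b"])
         (use that in \<open>auto intro!: continuous_intros sub right\<close>)
  qed simp
  then have "closure J = B" using simple sub[OF ne(1)] ne(2) unfolding simple_cstar_def by blast
  then have "1 \<in> closure J" using cstar_subalgebraD(1)[OF B] by simp
  then obtain j where "j \<in> J" "dist j 1 < 1"
    unfolding closure_approachable using zero_less_one by blast
  then have j: "j \<in> J" "norm (1 - j) < 1" by (simp_all add: dist_norm norm_minus_commute)
  then obtain g where "g \<in> B" "j * g = 1" using right_inverse_near_one[OF B, of j] JB by blast
  then show ?thesis using right[of g j] j by simp
qed

definition left_independent :: "'a::unital_cstar_algebra set \<Rightarrow> 'a set \<Rightarrow> bool" where
  "left_independent B S \<longleftrightarrow>
     (\<forall>b. (\<forall>s\<in>S. b s \<in> B) \<longrightarrow> (\<Sum>s\<in>S. b s * s) = 0 \<longrightarrow> (\<forall>s\<in>S. b s = 0))"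

text \<open>
  The coefficients at \<open>w\<close> of the relations between the elements of \<open>F\<close> form an ideal of \<open>B\<close>. It is a
  right ideal because the unitaries normalize \<open>B\<close>: multiplying a relation on the right by \<open>a'\<close> replaces
  the coefficient \<open>c u\<close> by \<open>c u (u a' u*)\<close>. As it contains \<open>1\<close>, some relation can be solved for \<open>w\<close>.
\<close>

lemma dependent_normalizer_redundant:
  fixes A B :: "'a::unital_cstar_algebra set"
  assumes B: "unital_cstar_subalgebra B" and simple: "simple_cstar B"
    and F: "finite F" "F \<subseteq> normalizer A B"
    and b: "\<And>u. u \<in> F \<Longrightarrow> b u \<in> B" "(\<Sum>u\<in>F. b u * u) = 0" and w: "w \<in> F" "b w \<noteq> 0"
  shows "w \<in> left_span B (F - {w})"
proof -
  define J where "J = {c w | c. (\<forall>u\<in>F. c u \<in> B) \<and> (\<Sum>u\<in>F. c u * u) = 0}"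
  have JI: "c w \<in> J" if "\<And>u. u \<in> F \<Longrightarrow> c u \<in> B" "(\<Sum>u\<in>F. c u * u) = 0" for c
    unfolding J_def using that by blast
  have JE: "\<exists>c. x = c w \<and> (\<forall>u\<in>F. c u \<in> B) \<and> (\<Sum>u\<in>F. c u * u) = 0" if "x \<in> J" for x
    using that unfolding J_def by blast
  note Bd = cstar_subalgebraD[OF B]
  note N = normalizerD[OF subsetD[OF F(2)]]
  have "1 \<in> J"
  proof (rule simple_ideal_contains_one[OF B simple])
    show "J \<subseteq> B" unfolding J_def using w by blast
    show "b w \<in> J" "b w \<noteq> 0" using JI b w by auto
    fix x assume "x \<in> J"
    then obtain c where c: "x = c w" "\<forall>u\<in>F. c u \<in> B" "(\<Sum>u\<in>F. c u * u) = 0" using JE by blast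
    {
      fix y assume "y \<in> J"
      then obtain c' where c': "y = c' w" "\<forall>u\<in>F. c' u \<in> B" "(\<Sum>u\<in>F. c' u * u) = 0" using JE by blast
      show "x + y \<in> J" unfolding c(1) c'(1)
        by (rule JI[of "\<lambda>u. c u + c' u"]) (use c c' in \<open>simp_all add: Bd distrib_right sum.distrib\<close>)
    next
      fix a assume a: "a \<in> B"
      show "a * x \<in> J" unfolding c(1)
        by (rule JI[of "\<lambda>u. a * c u"])
           (use c a in \<open>simp_all add: Bd mult.assoc flip: sum_distrib_left\<close>)
      \<comment> \<open>Chosen so that the coefficient at \<open>w\<close> is multiplied by \<open>w a' w* = a\<close>.\<close>
      define a' where "a' = star w * a * w"
      have a': "a' \<in> B" unfolding a'_def using N(5)[OF w(1) a] .
      have "c w * (w * a' * star w) \<in> J"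
      proof (rule JI[of "\<lambda>u. c u * (u * a' * star u)"])
        show "c u * (u * a' * star u) \<in> B" if "u \<in> F" for u
          using c(2) that N(4)[OF that a'] Bd(6) by blast
        have "(\<Sum>u\<in>F. c u * (u * a' * star u) * u) = (\<Sum>u\<in>F. c u * u) * a'"
          unfolding sum_distrib_right
        proof (rule sum.cong[OF refl])
          fix u assume u: "u \<in> F"
          have "c u * (u * a' * star u) * u = c u * u * a' * (star u * u)" by (simp only: mult.assoc)
          then show "c u * (u * a' * star u) * u = c u * u * a'" by (simp add: N(2)[OF u])
        qed
        then show "(\<Sum>u\<in>F. c u * (u * a' * star u) * u) = 0" by (simp add: c(3))
      qed
      moreover have "w * a' * star w = (w * star w) * a * (w * star w)"
        unfolding a'_def by (simp only: mult.assoc)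
      ultimately show "x * a \<in> J" unfolding c(1) by (simp add: N(3)[OF w(1)])
    }
  qed
  then obtain c where c: "1 = c w" "\<forall>u\<in>F. c u \<in> B" "(\<Sum>u\<in>F. c u * u) = 0" using JE by blast
  show ?thesis
  proof (rule left_spanI[of _ "\<lambda>u. - c u"])
    show "- c u \<in> B" if "u \<in> F - {w}" for u using that c(2) Bd(9) by blast
    have "(\<Sum>u\<in>F. c u * u) = c w * w + (\<Sum>u\<in>F - {w}. c u * u)" by (rule sum.remove[OF F(1) w(1)])
    then show "w = (\<Sum>u\<in>F - {w}. - c u * u)"
      by (simp add: c(3) sum_negf flip: c(1)) (simp add: eq_neg_iff_add_eq_0)
  qed
qed

lemma independent_normalizers:
  fixes A B :: "'a::unital_cstar_algebra set"
  assumes B: "unital_cstar_subalgebra B" and simple: "simple_cstar B"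
    and "finite F" "F \<subseteq> normalizer A B" "A \<subseteq> left_span B F"
  shows "\<exists>F'. finite F' \<and> F' \<subseteq> normalizer A B \<and> A \<subseteq> left_span B F' \<and> left_independent B F'"
  using assms(3-)
proof (induction F rule: finite_psubset_induct)
  case (psubset F)
  show ?case
  proof (cases "left_independent B F")
    case False
    then obtain b w where b: "\<forall>u\<in>F. b u \<in> B" "(\<Sum>u\<in>F. b u * u) = 0" and w: "w \<in> F" "b w \<noteq> 0"
      unfolding left_independent_def by blast
    have red: "w \<in> left_span B (F - {w})"
      by (rule dependent_normalizer_redundant[OF B simple psubset.hyps psubset.prems(1) _ b(2) w])
         (use b in blast)
    have "A \<subseteq> left_span B (F - {w})"
    proof
      fix x assume "x \<in> A"
      then obtain c where c: "\<And>s. s \<in> F \<Longrightarrow> c s \<in> B" "x = (\<Sum>s\<in>F. c s * s)"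
        using psubset.prems(2) by (blast elim: left_spanE)
      have "s \<in> left_span B (F - {w})" if "s \<in> F" for s
        using red left_span_base[OF B, of "F - {w}" s] that psubset.hyps by (cases "s = w") auto
      then show "x \<in> left_span B (F - {w})" unfolding c(2)
        by (intro left_span_combination[OF B] c(1))
    qed
    then show ?thesis using psubset.IH[of "F - {w}"] psubset.prems w by blast
  qed (use psubset in blast)
qed

text \<open>
  The coordinates with respect to an independent family of unitaries are \<open>x \<mapsto> E (x v\<^sub>u)\<close>, where
  \<open>v\<^sub>u\<close> is assembled from the coordinates \<open>c l u\<close> of the quasi-basis. The two expansions of \<open>x b\<close>, one
  directly and one by multiplying that of \<open>x\<close> by \<open>b\<close>, have the same coordinates; since \<open>E\<close> is
  faithful, this says \<open>b v\<^sub>u = v\<^sub>u (u b u*)\<close>. The statement is about the adjoints \<open>p\<^sub>u = v\<^sub>u*\<close>.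
\<close>

lemma normalizer_dual_basis:
  fixes A B :: "'a::unital_cstar_algebra set"
  assumes A: "unital_cstar_subalgebra A" and B: "unital_cstar_subalgebra B" and BA: "B \<subseteq> A"
    and simple: "simple_cstar B" and reg: "regular_inclusion A B"
    and E: "conditional_expectation A B E" and L: "quasi_basis A E \<Lambda>"
  obtains F p where "F \<subseteq> normalizer A B" and "\<And>u. u \<in> F \<Longrightarrow> p u \<in> A"
    and "\<And>x. x \<in> A \<Longrightarrow> x = (\<Sum>u\<in>F. star u * E (p u * x))"
    and "\<And>u b. u \<in> F \<Longrightarrow> b \<in> B \<Longrightarrow> p u * b = u * b * star u * p u"
proof -
  note Ad = cstar_subalgebraD[OF A] and Bd = cstar_subalgebraD[OF B]
    and Ed = conditional_expectationD[OF E]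
  obtain F0 where F0: "finite F0" "F0 \<subseteq> normalizer A B" "A \<subseteq> left_span B F0"
    by (rule regular_inclusion_finitely_generated[OF A B BA reg E L])
  then obtain F where F: "finite F" "F \<subseteq> normalizer A B" "A \<subseteq> left_span B F"
    and ind: "left_independent B F"
    using independent_normalizers[OF B simple F0] by blast
  note N = normalizerD[OF subsetD[OF F(2)]]
  have LA: "l \<in> A" if "l \<in> \<Lambda>" for l using L that unfolding quasi_basis_def by blast
  have "\<forall>l\<in>\<Lambda>. \<exists>c. (\<forall>u\<in>F. c u \<in> B) \<and> star l = (\<Sum>u\<in>F. c u * u)"
  proof
    fix l assume "l \<in> \<Lambda>"
    then have "star l \<in> left_span B F" using LA Ad(10) F(3) by blast
    then show "\<exists>c. (\<forall>u\<in>F. c u \<in> B) \<and> star l = (\<Sum>u\<in>F. c u * u)"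
      unfolding left_span_def by blast
  qed
  from bchoice[OF this] obtain c where
    c: "\<And>l u. l \<in> \<Lambda> \<Longrightarrow> u \<in> F \<Longrightarrow> c l u \<in> B" "\<And>l. l \<in> \<Lambda> \<Longrightarrow> star l = (\<Sum>u\<in>F. c l u * u)"
    by blast
  define v where "v u = (\<Sum>l\<in>\<Lambda>. l * c l u)" for u
  have v: "v u \<in> A" if "u \<in> F" for u
    unfolding v_def using that LA c(1) BA by (intro cstar_subalgebra_sum[OF A] Ad(6)) auto
  have expand: "x = (\<Sum>u\<in>F. E (x * v u) * u)" if x: "x \<in> A" for x
  proof -
    have Exv: "E (x * v u) = (\<Sum>l\<in>\<Lambda>. E (x * l) * c l u)" if u: "u \<in> F" for u
    proof -
      have "E (x * v u) = E (\<Sum>l\<in>\<Lambda>. (x * l) * c l u)"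
        unfolding v_def by (simp add: sum_distrib_left mult.assoc)
      also have "\<dots> = (\<Sum>l\<in>\<Lambda>. E ((x * l) * c l u))"
        using x LA c(1) u BA by (intro conditional_expectation_sum[OF A B E] Ad(6)) auto
      also have "\<dots> = (\<Sum>l\<in>\<Lambda>. E (x * l) * c l u)"
        using x LA c(1) u by (intro sum.cong refl Ed(5) Ad(6)) auto
      finally show ?thesis .
    qed
    have "x = (\<Sum>l\<in>\<Lambda>. E (x * l) * star l)" using L x unfolding quasi_basis_def by blast
    also have "\<dots> = (\<Sum>l\<in>\<Lambda>. \<Sum>u\<in>F. E (x * l) * c l u * u)"
      by (rule sum.cong) (simp_all add: c(2) sum_distrib_left mult.assoc)
    also have "\<dots> = (\<Sum>u\<in>F. \<Sum>l\<in>\<Lambda>. E (x * l) * c l u * u)" by (rule sum.swap)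
    also have "\<dots> = (\<Sum>u\<in>F. E (x * v u) * u)"
      by (rule sum.cong) (simp_all add: Exv sum_distrib_right)
    finally show ?thesis .
  qed
  have intertwine: "b * v u = v u * (u * b * star u)" if u: "u \<in> F" and b: "b \<in> B" for u b
  proof -
    define \<sigma> where "\<sigma> w = w * b * star w" for w
    have \<sigma>: "\<sigma> w \<in> B" if "w \<in> F" for w unfolding \<sigma>_def using N(4)[OF that b] .
    have \<sigma>u: "\<sigma> w * w = w * b" if "w \<in> F" for w
      unfolding \<sigma>_def using N(2)[OF that] by (simp add: mult.assoc)
    have bA: "b \<in> A" and \<sigma>A: "\<And>w. w \<in> F \<Longrightarrow> \<sigma> w \<in> A" using b \<sigma> BA by auto
    have "b * v u - v u * \<sigma> u = 0"
    proof (rule quasi_basis_expectation_faithful[OF A E L])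
      show "b * v u - v u * \<sigma> u \<in> A" by (intro Ad bA \<sigma>A v u)
      fix x assume x: "x \<in> A"
      have "(\<Sum>w\<in>F. (E (x * b * v w) - E (x * v w) * \<sigma> w) * w)
          = (\<Sum>w\<in>F. E (x * b * v w) * w) - (\<Sum>w\<in>F. E (x * v w) * w) * b"
        by (simp add: left_diff_distrib sum_subtractf sum_distrib_right mult.assoc \<sigma>u cong: sum.cong)
      also have "\<dots> = 0" using expand[OF x] expand[OF Ad(6)[OF x bA]] by simp
      finally have "\<forall>w\<in>F. E (x * b * v w) - E (x * v w) * \<sigma> w = 0"
        using ind[unfolded left_independent_def, rule_format, of "\<lambda>w. E (x * b * v w) - E (x * v w) * \<sigma> w"]
        by (auto intro!: Bd Ed(1) Ad x bA v \<sigma>)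
      then have "E (x * b * v u) = E (x * v u) * \<sigma> u" using u by auto
      also have "\<dots> = E (x * v u * \<sigma> u)" by (intro Ed(5)[symmetric] Ad \<sigma> x v u)
      finally have "E (x * b * v u) = E (x * v u * \<sigma> u)" .
      moreover have "E (x * b * v u) = E (x * (b * v u - v u * \<sigma> u) + x * v u * \<sigma> u)"
        by (simp add: right_diff_distrib mult.assoc)
      moreover have "\<dots> = E (x * (b * v u - v u * \<sigma> u)) + E (x * v u * \<sigma> u)"
        by (intro Ed(3) Ad x bA v \<sigma>A u)
      ultimately show "E (x * (b * v u - v u * \<sigma> u)) = 0" by simp
    qed
    then show ?thesis by (simp add: \<sigma>_def)
  qed
  show ?thesis
  proof (rule that[of F "\<lambda>u. star (v u)"])
    show "star (v u) \<in> A" if "u \<in> F" for u by (rule Ad(10)[OF v[OF that]])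
    show "x = (\<Sum>u\<in>F. star u * E (star (v u) * x))" if x: "x \<in> A" for x
    proof -
      have "star (star x) = (\<Sum>u\<in>F. star (E (star x * v u) * u))"
        using arg_cong[OF expand[OF Ad(10)[OF x]], of star] by (simp only: star_sum)
      also have "\<dots> = (\<Sum>u\<in>F. star u * E (star (v u) * x))"
      proof (rule sum.cong[OF refl])
        fix u assume u: "u \<in> F"
        have "star (E (star x * v u)) = E (star (star x * v u))"
          by (intro conditional_expectation_star[OF A E, symmetric] Ad x v u)
        then show "star (E (star x * v u) * u) = star u * E (star (v u) * x)"
          by (simp add: star_mult star_star)
      qed
      finally show ?thesis by (simp add: star_star)
    qed
    show "star (v u) * b = u * b * star u * star (v u)" if u: "u \<in> F" and b: "b \<in> B" for u b
    proof -
      have "star (star b * v u) = star (v u * (u * star b * star u))"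
        by (simp add: intertwine[OF u Bd(10)[OF b]])
      then show ?thesis by (simp add: star_mult star_star mult.assoc)
    qed
  qed (rule F)
qed

section \<open>The basic construction\<close>

lemma rel_commutant_mult:
  assumes "unital_cstar_subalgebra A" "x \<in> rel_commutant C A" "y \<in> rel_commutant C A"
  shows "x * y \<in> rel_commutant C A"
proof -
  have "c * (x * y) = x * y * c" if "c \<in> C" for c
    using assms(2,3) that unfolding rel_commutant_def by (simp flip: mult.assoc) (simp add: mult.assoc)
  then show ?thesis using assms cstar_subalgebraD(6) unfolding rel_commutant_def by blast
qed

lemma basic_constructionD:
  assumes "basic_construction A E A1 e"
  shows "unital_cstar_subalgebra A1" "A \<subseteq> A1" "e \<in> A1"
  using assms unfolding basic_construction_def by blast+

text \<open>
  The identification of \<open>A1\<close> with operators on \<open>A\<close> lets every \<open>z \<in> A1\<close> act on the elements of \<open>A\<close>. The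
  locale collects the properties of this action, which is faithful (\<open>act_eqI\<close>), so that identities
  in \<open>A1\<close> can be verified on vectors.
\<close>

locale basic_construction_action =
  fixes A B A1 :: "'a::unital_cstar_algebra set" and E :: "'a \<Rightarrow> 'a" and e :: 'a
    and act :: "'a \<Rightarrow> 'a \<Rightarrow> 'a"
  assumes A: "unital_cstar_subalgebra A" and B: "unital_cstar_subalgebra B" and BA: "B \<subseteq> A"
    and E: "conditional_expectation A B E"
    and A1: "unital_cstar_subalgebra A1" and AA1: "A \<subseteq> A1" and eA1: "e \<in> A1"
    and act_closed: "z \<in> A1 \<Longrightarrow> \<xi> \<in> A \<Longrightarrow> act z \<xi> \<in> A"
    and act_add: "z \<in> A1 \<Longrightarrow> w \<in> A1 \<Longrightarrow> \<xi> \<in> A \<Longrightarrow> act (z + w) \<xi> = act z \<xi> + act w \<xi>"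
    and act_mult: "z \<in> A1 \<Longrightarrow> w \<in> A1 \<Longrightarrow> \<xi> \<in> A \<Longrightarrow> act (z * w) \<xi> = act z (act w \<xi>)"
    and act_left: "a \<in> A \<Longrightarrow> \<xi> \<in> A \<Longrightarrow> act a \<xi> = a * \<xi>"
    and act_jones: "\<xi> \<in> A \<Longrightarrow> act e \<xi> = E \<xi>"
    and act_eqI: "z \<in> A1 \<Longrightarrow> w \<in> A1 \<Longrightarrow> (\<And>\<xi>. \<xi> \<in> A \<Longrightarrow> act z \<xi> = act w \<xi>) \<Longrightarrow> z = w"
    and act_form: "z \<in> A1 \<Longrightarrow> \<exists>(n::nat) x y. (\<forall>i<n. x i \<in> A \<and> y i \<in> A) \<and>
           (\<forall>\<xi>\<in>A. act z \<xi> = (\<Sum>i<n. x i * E (y i * \<xi>)))"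
begin

lemmas A_closed = cstar_subalgebraD[OF A] and A1_closed = cstar_subalgebraD[OF A1]
  and E_props = conditional_expectationD[OF E]

lemma E_closed: "\<xi> \<in> A \<Longrightarrow> E \<xi> \<in> A"
  using E_props(1) BA by blast

lemma act_sum:
  assumes "\<And>i. i \<in> I \<Longrightarrow> z i \<in> A1" "\<xi> \<in> A"
  shows "act (\<Sum>i\<in>I. z i) \<xi> = (\<Sum>i\<in>I. act (z i) \<xi>)"
  using assms(1)
  by (induction I rule: infinite_finite_induct)
     (auto simp: act_left A_closed assms(2) act_add cstar_subalgebra_sum[OF A1])

lemma jones_projection_commutes:
  assumes b: "b \<in> B"
  shows "b * e = e * b"
proof (rule act_eqI)
  have bA: "b \<in> A" "b \<in> A1" using b BA AA1 by auto
  show "b * e \<in> A1" "e * b \<in> A1" by (intro A1_closed(6) bA eA1)+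
  fix \<xi> assume \<xi>: "\<xi> \<in> A"
  show "act (b * e) \<xi> = act (e * b) \<xi>"
    by (simp add: act_mult act_left act_jones bA eA1 \<xi> E_closed A_closed(6) E_props(4)[OF b \<xi>])
qed

lemma jones_projection_compresses:
  assumes x: "x \<in> A"
  shows "e * x * e = E x * e"
proof (rule act_eqI)
  have x1: "x \<in> A1" "E x \<in> A1" "e * x \<in> A1"
    using x E_closed[OF x] AA1 A1_closed(6)[OF eA1] by auto
  show "e * x * e \<in> A1" "E x * e \<in> A1" by (intro A1_closed(6) x1 eA1)+
  fix \<xi> assume \<xi>: "\<xi> \<in> A"
  show "act (e * x * e) \<xi> = act (E x * e) \<xi>"
    by (simp add: act_mult act_left act_jones x x1 eA1 \<xi> E_closed A_closed(6) E_props(1,5))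
qed

lemma spanned_by_jones_products:
  assumes z: "z \<in> A1"
  obtains n :: nat and x y where "\<And>i. i < n \<Longrightarrow> x i \<in> A" "\<And>i. i < n \<Longrightarrow> y i \<in> A"
    "z = (\<Sum>i<n. x i * e * y i)"
proof -
  obtain n :: nat and x y where xy: "\<And>i. i < n \<Longrightarrow> x i \<in> A" "\<And>i. i < n \<Longrightarrow> y i \<in> A"
    and act: "\<And>\<xi>. \<xi> \<in> A \<Longrightarrow> act z \<xi> = (\<Sum>i<n. x i * E (y i * \<xi>))"
    using act_form[OF z] by blast
  have xy1: "x i \<in> A1" "y i \<in> A1" "x i * e \<in> A1" "x i * e * y i \<in> A1" if "i < n" for i
    using xy[OF that] AA1 eA1 by (auto intro!: A1_closed(6))
  have "z = (\<Sum>i<n. x i * e * y i)"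
  proof (rule act_eqI[OF z])
    show "(\<Sum>i<n. x i * e * y i) \<in> A1" using xy1 by (intro cstar_subalgebra_sum[OF A1]) auto
    fix \<xi> assume \<xi>: "\<xi> \<in> A"
    have "act (x i * e * y i) \<xi> = x i * E (y i * \<xi>)" if i: "i < n" for i
      using xy[OF i] xy1[OF i]
      by (simp add: act_mult act_left act_jones eA1 \<xi> E_closed A_closed(6))
    then show "act z \<xi> = act (\<Sum>i<n. x i * e * y i) \<xi>"
      by (subst act_sum) (auto simp: xy1 \<xi> act)
  qed
  with xy show ?thesis by (rule that)
qed

text \<open>Operators of the form \<open>\<xi> \<mapsto> (\<Sum>k. x k E (y k \<xi>))\<close> inherit right \<open>B\<close>-linearity from \<open>E\<close>.\<close>

lemma act_right_linear:
  assumes z: "z \<in> A1" and \<xi>: "\<And>i. i \<in> I \<Longrightarrow> \<xi> i \<in> A" and b: "\<And>i. i \<in> I \<Longrightarrow> b i \<in> B"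
  shows "act z (\<Sum>i\<in>I. \<xi> i * b i) = (\<Sum>i\<in>I. act z (\<xi> i) * b i)"
proof -
  obtain n :: nat and x y where xy: "\<And>k. k < n \<Longrightarrow> x k \<in> A" "\<And>k. k < n \<Longrightarrow> y k \<in> A"
    and act: "\<And>\<xi>. \<xi> \<in> A \<Longrightarrow> act z \<xi> = (\<Sum>k<n. x k * E (y k * \<xi>))"
    using act_form[OF z] by blast
  have m: "\<xi> i * b i \<in> A" if "i \<in> I" for i using A_closed(6) \<xi> b BA that by blast
  have "E (y k * (\<Sum>i\<in>I. \<xi> i * b i)) = (\<Sum>i\<in>I. E (y k * \<xi> i) * b i)" if k: "k < n" for k
  proof -
    have "E (y k * (\<Sum>i\<in>I. \<xi> i * b i)) = (\<Sum>i\<in>I. E (y k * (\<xi> i * b i)))"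
      unfolding sum_distrib_left
      by (rule conditional_expectation_sum[OF A B E]) (rule A_closed(6)[OF xy(2)[OF k] m])
    also have "\<dots> = (\<Sum>i\<in>I. E (y k * \<xi> i) * b i)"
    proof (rule sum.cong[OF refl])
      fix i assume i: "i \<in> I"
      show "E (y k * (\<xi> i * b i)) = E (y k * \<xi> i) * b i"
        using E_props(5)[OF b[OF i] A_closed(6)[OF xy(2)[OF k] \<xi>[OF i]]] by (simp add: mult.assoc)
    qed
    finally show ?thesis .
  qed
  then have "act z (\<Sum>i\<in>I. \<xi> i * b i) = (\<Sum>k<n. \<Sum>i\<in>I. x k * E (y k * \<xi> i) * b i)"
    by (subst act) (simp_all add: cstar_subalgebra_sum[OF A] m sum_distrib_left mult.assoc)
  also have "\<dots> = (\<Sum>i\<in>I. act z (\<xi> i) * b i)"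
    by (subst sum.swap) (simp add: act \<xi> sum_distrib_right)
  finally show ?thesis .
qed

text \<open>
  A right \<open>B\<close>-linear operator is determined by its values \<open>a i\<close> on the \<open>\<kappa> i\<close>, and the operator with
  these values is \<open>(\<Sum>i. a i e \<mu> i)\<close>. For \<open>c \<in> C\<close> the element \<open>a i\<close> commutes with \<open>c\<close> since
  \<open>c z(\<kappa> i) = z(c \<kappa> i) = z(\<kappa> i c) = z(\<kappa> i) c\<close>.
\<close>

lemma rel_commutant_expand:
  assumes C: "C \<subseteq> B" and \<kappa>: "\<And>i. i \<in> I \<Longrightarrow> \<kappa> i \<in> rel_commutant C A"
    and \<mu>: "\<And>i. i \<in> I \<Longrightarrow> \<mu> i \<in> A"
    and expand: "\<And>x. x \<in> A \<Longrightarrow> x = (\<Sum>i\<in>I. \<kappa> i * E (\<mu> i * x))"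
    and z: "z \<in> rel_commutant C A1"
  obtains a where "\<And>i. i \<in> I \<Longrightarrow> a i \<in> rel_commutant C A" "z = (\<Sum>i\<in>I. a i * e * \<mu> i)"
proof -
  have z1: "z \<in> A1" and zC: "\<And>c. c \<in> C \<Longrightarrow> c * z = z * c"
    using z unfolding rel_commutant_def by auto
  have \<kappa>A: "\<kappa> i \<in> A" and \<kappa>C: "\<And>c. c \<in> C \<Longrightarrow> c * \<kappa> i = \<kappa> i * c" if "i \<in> I" for i
    using \<kappa>[OF that] unfolding rel_commutant_def by auto
  define a where "a i = act z (\<kappa> i)" for i
  have aA: "a i \<in> A" if "i \<in> I" for i unfolding a_def by (rule act_closed[OF z1 \<kappa>A[OF that]])
  have aC: "c * a i = a i * c" if i: "i \<in> I" and c: "c \<in> C" for i c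
  proof -
    have cB: "c \<in> B" "c \<in> A" "c \<in> A1" using c C BA AA1 by auto
    have "c * a i = act (c * z) (\<kappa> i)"
      unfolding a_def by (simp add: act_mult cB z1 \<kappa>A[OF i] act_left act_closed)
    also have "\<dots> = act z (c * \<kappa> i)"
      unfolding zC[OF c] by (simp add: act_mult cB z1 \<kappa>A[OF i] act_left)
    also have "\<dots> = a i * c"
      using act_right_linear[OF z1, of "{i}" \<kappa> "\<lambda>_. c"] \<kappa>A[OF i] cB by (simp add: \<kappa>C[OF i c] a_def)
    finally show ?thesis .
  qed
  have m1: "a i \<in> A1" "a i * e \<in> A1" "\<mu> i \<in> A1" "a i * e * \<mu> i \<in> A1" if "i \<in> I" for i
    using aA[OF that] \<mu>[OF that] AA1 eA1 by (auto intro!: A1_closed(6))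
  have "z = (\<Sum>i\<in>I. a i * e * \<mu> i)"
  proof (rule act_eqI[OF z1])
    show "(\<Sum>i\<in>I. a i * e * \<mu> i) \<in> A1" by (intro cstar_subalgebra_sum[OF A1] m1)
    fix \<xi> assume \<xi>: "\<xi> \<in> A"
    have m: "\<mu> i * \<xi> \<in> A" "E (\<mu> i * \<xi>) \<in> B" if "i \<in> I" for i
      using A_closed(6)[OF \<mu>[OF that] \<xi>] E_props(1) by blast+
    have "act z \<xi> = act z (\<Sum>i\<in>I. \<kappa> i * E (\<mu> i * \<xi>))" using expand[OF \<xi>] by simp
    also have "\<dots> = (\<Sum>i\<in>I. a i * E (\<mu> i * \<xi>))"
      unfolding a_def by (rule act_right_linear[OF z1]) (use \<kappa>A m in auto)
    also have "\<dots> = (\<Sum>i\<in>I. act (a i * e * \<mu> i) \<xi>)"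
      by (rule sum.cong) (simp_all add: act_mult m1 eA1 \<xi> act_left \<mu> act_jones m aA E_closed)
    also have "\<dots> = act (\<Sum>i\<in>I. a i * e * \<mu> i) \<xi>" by (rule act_sum[symmetric]) (use m1 \<xi> in auto)
    finally show "act z \<xi> = act (\<Sum>i\<in>I. a i * e * \<mu> i) \<xi>" .
  qed
  moreover have "a i \<in> rel_commutant C A" if "i \<in> I" for i
    unfolding rel_commutant_def using aA aC that by blast
  ultimately show ?thesis using that by blast
qed

text \<open>
  This is the step from a pair of dual bases inside the relative commutant to the depth condition.
  The inclusion of the span holds because \<open>e\<close> commutes with \<open>B\<close>.
\<close>

lemma rel_commutant_eq_span:
  assumes C: "C \<subseteq> B" and \<kappa>: "\<And>i. i \<in> I \<Longrightarrow> \<kappa> i \<in> rel_commutant C A"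
    and \<mu>: "\<And>i. i \<in> I \<Longrightarrow> \<mu> i \<in> rel_commutant C A"
    and expand: "\<And>x. x \<in> A \<Longrightarrow> x = (\<Sum>i\<in>I. \<kappa> i * E (\<mu> i * x))"
  shows "rel_commutant C A1 =
    cspan {x * e * y | x y. x \<in> rel_commutant C A \<and> y \<in> rel_commutant C A}" (is "_ = cspan ?G")
proof
  have \<mu>A: "\<mu> i \<in> A" if "i \<in> I" for i using \<mu>[OF that] unfolding rel_commutant_def by blast
  show "rel_commutant C A1 \<subseteq> cspan ?G"
  proof
    fix z assume z: "z \<in> rel_commutant C A1"
    obtain a where a: "\<And>i. i \<in> I \<Longrightarrow> a i \<in> rel_commutant C A" "z = (\<Sum>i\<in>I. a i * e * \<mu> i)"
      by (rule rel_commutant_expand[OF C \<kappa> \<mu>A expand z]) auto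
    have "a i * e * \<mu> i \<in> ?G" if "i \<in> I" for i using a(1) \<mu> that by blast
    then show "z \<in> cspan ?G" unfolding a(2) by (intro cstar.span_sum cstar.span_base)
  qed
  show "cspan ?G \<subseteq> rel_commutant C A1"
  proof (rule cstar.span_minimal)
    have e: "e \<in> rel_commutant C A1"
      unfolding rel_commutant_def using jones_projection_commutes C eA1 by blast
    have sub: "rel_commutant C A \<subseteq> rel_commutant C A1" unfolding rel_commutant_def using AA1 by blast
    show "?G \<subseteq> rel_commutant C A1"
      using e sub by (auto intro!: rel_commutant_mult[OF A1])
    show "cstar.subspace (rel_commutant C A1)"
      unfolding cstar.subspace_def rel_commutant_def
      by (auto intro: A1_closed
          simp: distrib_left distrib_right mult_scaleC_left mult_scaleC_right)
  qed
qed

end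

lemma basic_construction_has_action:
  assumes A: "unital_cstar_subalgebra A" and B: "unital_cstar_subalgebra B" and BA: "B \<subseteq> A"
    and E: "conditional_expectation A B E" and bc: "basic_construction A E A1 e"
  obtains act where "basic_construction_action A B A1 E e act"
proof -
  obtain \<pi> where bij: "bij_betw \<pi> A1 (basic_construction_operators A E)"
    and add: "\<forall>x\<in>A1. \<forall>y\<in>A1. \<pi> (x + y) = (\<lambda>\<xi>\<in>A. \<pi> x \<xi> + \<pi> y \<xi>)"
    and mult: "\<forall>x\<in>A1. \<forall>y\<in>A1. \<pi> (x * y) = compose A (\<pi> x) (\<pi> y)"
    and left: "\<forall>a\<in>A. \<pi> a = left_mult_operator A a" and e: "\<pi> e = jones_operator A E"
    using bc unfolding basic_construction_def by blast
  have EA: "E x \<in> A" if "x \<in> A" for x using conditional_expectationD(1)[OF E that] BA by blast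
  have ops: "\<pi> z \<in> basic_construction_operators A E" if "z \<in> A1" for z
    using bij_betwE[OF bij] that by blast
  have ext: "\<pi> z \<in> A \<rightarrow>\<^sub>E A" if "z \<in> A1" for z
    using ops[OF that] unfolding basic_construction_operators_def adjointable_operators_def by blast
  have "basic_construction_action A B A1 E e \<pi>"
  proof (unfold_locales; (intro A B BA E basic_constructionD[OF bc])?)
    show "\<pi> z \<xi> \<in> A" if "z \<in> A1" "\<xi> \<in> A" for z \<xi>
      using ext[OF that(1)] that(2) by (rule PiE_mem)
    show "\<pi> (z + w) \<xi> = \<pi> z \<xi> + \<pi> w \<xi>" if "z \<in> A1" "w \<in> A1" "\<xi> \<in> A" for z w \<xi>
      using add that by simp
    show "\<pi> (z * w) \<xi> = \<pi> z (\<pi> w \<xi>)" if "z \<in> A1" "w \<in> A1" "\<xi> \<in> A" for z w \<xi>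
      using mult that by (simp add: compose_eq)
    show "\<pi> a \<xi> = a * \<xi>" if "a \<in> A" "\<xi> \<in> A" for a \<xi>
      using left that by (simp add: left_mult_operator_def)
    show "\<pi> e \<xi> = E \<xi>" if "\<xi> \<in> A" for \<xi> using that by (simp add: e jones_operator_def)
    show "z = w" if z: "z \<in> A1" and w: "w \<in> A1" and eq: "\<And>\<xi>. \<xi> \<in> A \<Longrightarrow> \<pi> z \<xi> = \<pi> w \<xi>" for z w
    proof (rule inj_onD[OF bij_betw_imp_inj_on[OF bij] _ z w])
      show "\<pi> z = \<pi> w" by (rule PiE_ext[OF ext[OF z] ext[OF w] eq])
    qed
    show "\<exists>(n::nat) x y. (\<forall>i<n. x i \<in> A \<and> y i \<in> A) \<and>
        (\<forall>\<xi>\<in>A. \<pi> z \<xi> = (\<Sum>i<n. x i * E (y i * \<xi>)))" if z1: "z \<in> A1" for z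
    proof -
      obtain n :: nat and x y where xy: "\<forall>i<n. x i \<in> A \<and> y i \<in> A"
        and z: "\<pi> z = (\<lambda>\<xi>\<in>A. \<Sum>i<n. compose A (left_mult_operator A (x i))
          (compose A (jones_operator A E) (left_mult_operator A (y i))) \<xi>)"
        using ops[OF z1] unfolding basic_construction_operators_def by blast
      have "\<pi> z \<xi> = (\<Sum>i<n. x i * E (y i * \<xi>))" if "\<xi> \<in> A" for \<xi>
        using that xy EA cstar_subalgebraD(6)[OF A]
        by (simp add: z compose_eq left_mult_operator_def jones_operator_def)
      then show ?thesis using xy by blast
    qed
  qed
  then show ?thesis by (rule that)
qed

section \<open>A dual basis commuting with the small algebra\<close>

text \<open>
  The pair is \<open>\<kappa> u = u* e u\<close> and \<open>\<mu> u = d u* e p\<^sub>u\<close>. On \<open>x e y\<close> the dual expectation gives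
  \<open>E1 (\<mu> u x e y) = c d u* E (p\<^sub>u x) y\<close>, where \<open>c = E1 e\<close> is central in \<open>A\<close>. So \<open>d\<close> has to be the
  inverse of \<open>c\<close>; then \<open>\<kappa> u E1 (\<mu> u x e y) = u* E (p\<^sub>u x) e y\<close>, and these add up to \<open>x e y\<close>.
\<close>

lemma regular_basic_construction_dual_basis:
  fixes A B A1 :: "'a::unital_cstar_algebra set"
  assumes A: "unital_cstar_subalgebra A" and B: "unital_cstar_subalgebra B" and BA: "B \<subseteq> A"
    and simple: "simple_cstar B" and reg: "regular_inclusion A B"
    and fin: "finite_index_expectation A B E" and bc: "basic_construction A E A1 e"
    and dual: "dual_expectation A E A1 e E1"
  obtains F :: "'a set" and \<kappa> \<mu> where
    "\<And>u. u \<in> F \<Longrightarrow> \<kappa> u \<in> rel_commutant B A1" "\<And>u. u \<in> F \<Longrightarrow> \<mu> u \<in> rel_commutant B A1"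
    "\<And>x. x \<in> A1 \<Longrightarrow> x = (\<Sum>u\<in>F. \<kappa> u * E1 (\<mu> u * x))"
proof -
  note bcD = basic_constructionD[OF bc]
  obtain \<Lambda> where E: "conditional_expectation A B E" and L: "quasi_basis A E \<Lambda>"
    using fin unfolding finite_index_expectation_def by blast
  have E1: "conditional_expectation A1 A E1"
    using dual unfolding dual_expectation_def finite_index_expectation_def by blast
  define c where "c = cstar_inverse (watatani_index A E)"
  have E1e: "E1 (x * e * y) = c * (x * y)" if "x \<in> A" "y \<in> A" for x y
    using dual that unfolding dual_expectation_def c_def by blast
  note Ad = cstar_subalgebraD[OF A] and A1d = cstar_subalgebraD[OF bcD(1)]
    and Ed = conditional_expectationD[OF E] and E1d = conditional_expectationD[OF E1]
  obtain F p where F: "F \<subseteq> normalizer A B" and p: "\<And>u. u \<in> F \<Longrightarrow> p u \<in> A"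
    and expand: "\<And>x. x \<in> A \<Longrightarrow> x = (\<Sum>u\<in>F. star u * E (p u * x))"
    and pB: "\<And>u b. u \<in> F \<Longrightarrow> b \<in> B \<Longrightarrow> p u * b = u * b * star u * p u"
    by (rule normalizer_dual_basis[OF A B BA simple reg E L]) blast+
  note N = normalizerD[OF subsetD[OF F]]
  obtain act where "basic_construction_action A B A1 E e act"
    by (rule basic_construction_has_action[OF A B BA E bc])
  then interpret basic_construction_action A B A1 E e act .
  have uA: "u \<in> A" "star u \<in> A" if "u \<in> F" for u using N(1)[OF that] Ad(10) by auto
  have into: "x \<in> A1" if "x \<in> A" for x using that bcD(2) by blast

  have unit: "x * e * y = (\<Sum>u\<in>F. star u * E (p u * x) * e * y)" if "x \<in> A" for x y
    using arg_cong[OF expand[OF that], of "\<lambda>t. t * e * y"] by (simp add: sum_distrib_right)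

  have cA: "c \<in> A"
    using E1d(1)[OF bcD(3)] E1e[of 1 1] Ad(1) by simp
  have c_central: "a * c = c * a" if a: "a \<in> A" for a
    using E1e[OF a Ad(1)] E1e[OF Ad(1) Ad(1)] E1d(4)[OF a bcD(3)] by simp
  \<comment> \<open>Applying \<open>E1\<close> to \<open>1 = (\<Sum>u\<in>F. u* e p\<^sub>u)\<close> shows that this element inverts \<open>c\<close>.\<close>
  define d where "d = (\<Sum>u\<in>F. star u * p u)"
  have dA: "d \<in> A" unfolding d_def using uA p by (intro cstar_subalgebra_sum[OF A] Ad(6))
  have cd: "c * d = 1"
  proof -
    have one: "1 = (\<Sum>u\<in>F. star u * e * p u)"
    proof -
      \<comment> \<open>The sum is a left unit for the products \<open>x e y\<close>, which span \<open>A1\<close>.\<close>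
      obtain n :: nat and x y where xy: "\<And>i. i < n \<Longrightarrow> x i \<in> A" "\<And>i. i < n \<Longrightarrow> y i \<in> A"
        and 1: "1 = (\<Sum>i<n. x i * e * y i)"
        by (rule spanned_by_jones_products[OF A1d(1)]) blast
      have "(\<Sum>u\<in>F. star u * E (p u * x i) * e * y i) = (\<Sum>u\<in>F. star u * e * p u) * (x i * e * y i)"
        if i: "i < n" for i
        unfolding sum_distrib_right
      proof (rule sum.cong[OF refl])
        fix u assume u: "u \<in> F"
        have "star u * e * p u * (x i * e * y i) = star u * (e * (p u * x i) * e) * y i"
          by (simp only: mult.assoc)
        also have "\<dots> = star u * E (p u * x i) * e * y i"
          using jones_projection_compresses[OF Ad(6)[OF p[OF u] xy(1)[OF i]]]
          by (simp add: mult.assoc)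
        finally show "star u * E (p u * x i) * e * y i = star u * e * p u * (x i * e * y i)" by simp
      qed
      then have "x i * e * y i = (\<Sum>u\<in>F. star u * e * p u) * (x i * e * y i)" if "i < n" for i
        using unit[OF xy(1)[OF that], of "y i"] that by simp
      then have "(\<Sum>i<n. x i * e * y i) = (\<Sum>u\<in>F. star u * e * p u) * (\<Sum>i<n. x i * e * y i)"
        by (simp only: sum_distrib_left) (rule sum.cong, simp_all)
      then show ?thesis by (simp flip: 1)
    qed
    have "1 = E1 (\<Sum>u\<in>F. star u * e * p u)" using E1d(2)[OF Ad(1)] one by simp
    also have "\<dots> = (\<Sum>u\<in>F. E1 (star u * e * p u))"
      using uA p into bcD(3) by (intro conditional_expectation_sum[OF bcD(1) A E1] A1d(6)) auto
    also have "\<dots> = c * d" unfolding d_def by (simp add: E1e uA p sum_distrib_left)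
    finally show ?thesis by simp
  qed
  have dc: "d * c = 1" using cd c_central[OF dA] by simp
  have d_central: "a * d = d * a" if a: "a \<in> A" for a
  proof -
    have "a * d = (d * c) * (a * d)" by (simp add: dc)
    also have "\<dots> = d * ((c * a) * d)" by (simp only: mult.assoc)
    also have "\<dots> = d * (a * (c * d))" by (simp only: c_central[OF a, symmetric] mult.assoc)
    finally show ?thesis by (simp add: cd)
  qed

  define \<kappa> where "\<kappa> u = star u * e * u" for u
  define \<mu> where "\<mu> u = d * (star u * e * p u)" for u
  have \<kappa>1: "\<kappa> u \<in> A1" and \<mu>1: "\<mu> u \<in> A1" if "u \<in> F" for u
    unfolding \<kappa>_def \<mu>_def by (intro A1d(6) bcD(3) into uA[OF that] p[OF that] dA)+
  show ?thesis
  proof (rule that[of F \<kappa> \<mu>])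
    fix u assume u: "u \<in> F"
    define \<sigma> where "\<sigma> b = u * b * star u" for b
    have \<sigma>: "\<sigma> b \<in> B" "b * star u = star u * \<sigma> b" "\<sigma> b * u = u * b" if "b \<in> B" for b
    proof -
      show "\<sigma> b \<in> B" unfolding \<sigma>_def by (rule N(4)[OF u that])
      have "star u * \<sigma> b = (star u * u) * b * star u" unfolding \<sigma>_def by (simp only: mult.assoc)
      then show "b * star u = star u * \<sigma> b" by (simp add: N(2)[OF u])
      show "\<sigma> b * u = u * b" unfolding \<sigma>_def by (simp add: mult.assoc N(2)[OF u])
    qed
    have move: "b * (star u * e * q) = star u * e * (\<sigma> b * q)" if b: "b \<in> B" for b q
    proof -
      have "b * (star u * e * q) = star u * (\<sigma> b * e) * q"
        by (metis \<sigma>(2)[OF b] mult.assoc)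
      then show ?thesis by (simp add: jones_projection_commutes[OF \<sigma>(1)[OF b]] mult.assoc)
    qed
    have "b * \<kappa> u = \<kappa> u * b" if b: "b \<in> B" for b
      unfolding \<kappa>_def move[OF b] by (simp add: \<sigma>(3)[OF b] mult.assoc)
    then show "\<kappa> u \<in> rel_commutant B A1" unfolding rel_commutant_def using \<kappa>1[OF u] by blast
    have "b * \<mu> u = \<mu> u * b" if b: "b \<in> B" for b
    proof -
      have "b * d = d * b" using d_central b BA by blast
      then have "b * \<mu> u = d * (b * (star u * e * p u))" unfolding \<mu>_def by (metis mult.assoc)
      also have "\<dots> = d * (star u * e * (p u * b))"
        unfolding move[OF b] by (simp add: \<sigma>_def pB[OF u b])
      finally show ?thesis unfolding \<mu>_def by (simp add: mult.assoc)
    qed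
    then show "\<mu> u \<in> rel_commutant B A1" unfolding rel_commutant_def using \<mu>1[OF u] by blast
  next
    fix z assume "z \<in> A1"
    then obtain n :: nat and x y where xy: "\<And>i. i < n \<Longrightarrow> x i \<in> A" "\<And>i. i < n \<Longrightarrow> y i \<in> A"
      and z: "z = (\<Sum>i<n. x i * e * y i)"
      by (rule spanned_by_jones_products) blast
    have xy1: "x i * e * y i \<in> A1" if "i < n" for i
      using xy[OF that] by (intro A1d(6) bcD(3) into)
    have term_eq: "\<kappa> u * E1 (\<mu> u * (x i * e * y i)) = star u * E (p u * x i) * e * y i"
      if u: "u \<in> F" and i: "i < n" for u i
    proof -
      define b where "b = E (p u * x i)"
      have b: "b \<in> B" "b \<in> A" unfolding b_def using Ed(1) Ad(6) p[OF u] xy(1)[OF i] BA by blast+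
      have "\<mu> u * (x i * e * y i) = d * star u * (e * (p u * x i) * e) * y i"
        unfolding \<mu>_def by (simp only: mult.assoc)
      also have "\<dots> = (d * star u * b) * e * y i"
        using jones_projection_compresses[OF Ad(6)[OF p[OF u] xy(1)[OF i]]]
        by (simp add: b_def mult.assoc)
      finally have "E1 (\<mu> u * (x i * e * y i)) = c * ((d * star u * b) * y i)"
        using E1e[of "d * star u * b" "y i"] dA uA[OF u] b xy[OF i] Ad(6) by simp
      also have "\<dots> = (c * d) * (star u * b * y i)" by (simp only: mult.assoc)
      also have "\<dots> = star u * b * y i" by (simp add: cd)
      finally have "\<kappa> u * E1 (\<mu> u * (x i * e * y i)) = star u * e * (u * star u) * b * y i"
        unfolding \<kappa>_def by (simp only: mult.assoc)
      also have "\<dots> = star u * (e * b) * y i" by (simp add: N(3)[OF u] mult.assoc)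
      also have "\<dots> = star u * b * e * y i" by (simp add: jones_projection_commutes[OF b(1), symmetric] mult.assoc)
      finally show ?thesis unfolding b_def .
    qed
    have "(\<Sum>u\<in>F. \<kappa> u * E1 (\<mu> u * z)) = (\<Sum>u\<in>F. \<Sum>i<n. \<kappa> u * E1 (\<mu> u * (x i * e * y i)))"
    proof (rule sum.cong[OF refl])
      fix u assume u: "u \<in> F"
      have "E1 (\<mu> u * z) = (\<Sum>i<n. E1 (\<mu> u * (x i * e * y i)))"
        unfolding z sum_distrib_left
        by (rule conditional_expectation_sum[OF bcD(1) A E1]) (use A1d(6) \<mu>1[OF u] xy1 in auto)
      then show "\<kappa> u * E1 (\<mu> u * z) = (\<Sum>i<n. \<kappa> u * E1 (\<mu> u * (x i * e * y i)))"
        by (simp add: sum_distrib_left)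
    qed
    also have "\<dots> = (\<Sum>i<n. \<Sum>u\<in>F. star u * E (p u * x i) * e * y i)"
      by (subst sum.swap) (simp add: term_eq)
    also have "\<dots> = z" unfolding z by (rule sum.cong) (simp_all add: xy flip: unit)
    finally show "z = (\<Sum>u\<in>F. \<kappa> u * E1 (\<mu> u * z))" by simp
  qed
qed

section \<open>Depth at most two\<close>

theorem theorem3p11:
  fixes A B :: "'a::unital_cstar_algebra set"
    and E\<^sub>0 :: "'a \<Rightarrow> 'a"
    and T :: "nat \<Rightarrow> 'a set" and e :: "nat \<Rightarrow> 'a" and E :: "nat \<Rightarrow> 'a \<Rightarrow> 'a"
  assumes "unital_cstar_subalgebra A" and "unital_cstar_subalgebra B" and "B \<subseteq> A"
    and "simple_cstar A" and "simple_cstar B"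
    and "regular_inclusion A B"
    and "\<exists>F. finite_index_expectation A B F"
    and "minimal_expectation A B E\<^sub>0"
    and "jones_tower A B E\<^sub>0 T e E"
  shows "finite_depth T e \<and> depth T e \<le> 2"
proof -
  have T0: "T 0 = B" and T1: "T 1 = A" and E0: "E 0 = E\<^sub>0"
    and step: "\<And>k. basic_construction (T (k + 1)) (E k) (T (k + 2)) (e (k + 1))"
      "\<And>k. dual_expectation (T (k + 1)) (E k) (T (k + 2)) (e (k + 1)) (E (k + 1))"
    using assms(9) unfolding jones_tower_def by blast+
  have bc1: "basic_construction A E\<^sub>0 (T 2) (e 1)" and dual1: "dual_expectation A E\<^sub>0 (T 2) (e 1) (E 1)"
    using step[of 0] T1 E0 by (simp_all add: numeral_2_eq_2)
  have bc2: "basic_construction (T 2) (E 1) (T 3) (e 2)"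
    using step(1)[of 1] by (simp add: numeral_eq_Suc)
  have E1: "conditional_expectation (T 2) A (E 1)"
    using dual1 unfolding dual_expectation_def finite_index_expectation_def by blast
  have fin: "finite_index_expectation A B E\<^sub>0"
    using assms(8) unfolding minimal_expectation_def by blast
  note bcD = basic_constructionD[OF bc1]
  obtain F :: "'a set" and \<kappa> \<mu> where
    dual_basis: "\<And>u. u \<in> F \<Longrightarrow> \<kappa> u \<in> rel_commutant B (T 2)"
      "\<And>u. u \<in> F \<Longrightarrow> \<mu> u \<in> rel_commutant B (T 2)"
      "\<And>x. x \<in> T 2 \<Longrightarrow> x = (\<Sum>u\<in>F. \<kappa> u * E 1 (\<mu> u * x))"
    by (rule regular_basic_construction_dual_basis[OF assms(1-3,5,6) fin bc1 dual1]) blast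
  obtain act where "basic_construction_action (T 2) A (T 3) (E 1) (e 2) act"
    by (rule basic_construction_has_action[OF bcD(1) assms(1) bcD(2) E1 bc2])
  then interpret basic_construction_action "T 2" A "T 3" "E 1" "e 2" act .
  have "rel_commutant B (T 3) =
      cspan {x * e 2 * y | x y. x \<in> rel_commutant B (T 2) \<and> y \<in> rel_commutant B (T 2)}"
    by (rule rel_commutant_eq_span[OF assms(3) dual_basis])
  then have "depth_condition T e 2" unfolding depth_condition_def T0 by simp
  then have 2: "(2::nat) \<ge> 1 \<and> depth_condition T e 2" by simp
  show ?thesis
    unfolding finite_depth_def depth_def using 2 Least_le[of "\<lambda>k. k \<ge> 1 \<and> depth_condition T e k" 2]
    by blast
qed

end
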